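(* Let $\mathfrak{g}$ be a finite-dimensional complex simple Lie algebra, let $P=P(M_\bullet)$ be an MV polytope for $\mathfrak{g}$, let $j\in I$, and write $\widetilde f_j(P)=P(M'_\bullet)$. Then for every chamber weight $\gamma\in\Gamma$ with $\langle h_j,\gamma\rangle=1$, $$M'_\gamma=\min\{M_\gamma,\ M_{s_j\gamma}+c_j(P)\},\qquad c_j(P)=M_{\varpi_j}-M_{s_j\varpi_j}-1.$$
   Context: Notation. $\mathfrak{g}$ has index set $I$, simple roots $\alpha_i$, simple coroots $h_i$, fundamental weights $\varpi_i$, and Cartan matrix $c_{ij}=\langle h_i,\alpha_j\rangle$. $W$ is the Weyl group, with simple reflections $s_i$ and longest element $w_0$. $\mathfrak{h}_{\mathbb{R}}$ is the real span of the coweight lattice. The chamber weights are $\Gamma=\{w\varpi_i: w\in W, i\in I\}$. MV polytopes. A collection of integers $M_\bullet=(M_\gamma)_{\gamma\in\Gamma}$ satisfying the edge inequalities $M_{w\varpi_i}+M_{ws_i\varpi_i}+\sum_{k\ne i}c_{ki}M_{w\varpi_k}\le0$ defines the polytope $P(M_\bullet)=\{h\in\mathfrak{h}_{\mathbb{R}}:\langle h,\gamma\rangle\ge M_\gamma\ \forall\gamma\}$. It is an MV polytope if $M_\bullet$ also satisfies Kamnitzer's tropical Plücker relations. MV polytopes are taken up to translation, normalized so that the vertex $\mu_{w_0}$ (defined by $\langle\mu_w,w\varpi_i\rangle=M_{w\varpi_i}$) is $0$. Kashiwara operator. The Kashiwara operator $\widetilde f_j$ on MV polytopes comes from Lusztig's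 canonical basis via Kamnitzer's bijection. It is characterized by $\widetilde f_j(P(M_\bullet))=P(M'_\bullet)$, where $M'_\bullet$ is the unique MV (BZ) datum with $M'_{\varpi_j}=M_{\varpi_j}-1$ and $M'_\gamma=M_\gamma$ for every $\gamma=w\varpi_i$ with $s_jw<w$. *)

theory Defs
  imports Complex_Main
begin

text \<open>
  Root datum of a finite-dimensional complex simple Lie algebra, encoded by its
  Cartan matrix  c i j = <h_i, alpha_j>  indexed by a finite type 'i (the index set I).
  Weights are integral weights, written in the basis of fundamental weights:
  a weight lam is the function  k \<mapsto> <h_k, lam>.
\<close>

type_synonym 'i weight = "'i \<Rightarrow> int"

definition simple_cartan :: "('i::finite \<Rightarrow> 'i \<Rightarrow> int) \<Rightarrow> bool" where
  "simple_cartan c \<longleftrightarrow>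
     (\<forall>i. c i i = 2) \<and>
     (\<forall>i j. i \<noteq> j \<longrightarrow> c i j \<le> 0) \<and>
     (\<forall>i j. c i j = 0 \<longleftrightarrow> c j i = 0) \<and>
     (\<exists>d :: 'i \<Rightarrow> real. (\<forall>i. d i > 0) \<and>
        (\<forall>i j. d i * real_of_int (c i j) = d j * real_of_int (c j i)) \<and>
        (\<forall>x :: 'i \<Rightarrow> real. x \<noteq> (\<lambda>_. 0) \<longrightarrow>
            (\<Sum>i\<in>UNIV. \<Sum>j\<in>UNIV. x i * d i * real_of_int (c i j) * x j) > 0)) \<and>
     (\<forall>J :: 'i set. J \<noteq> {} \<and> J \<noteq> UNIV \<longrightarrow> (\<exists>j\<in>J. \<exists>k\<in>UNIV - J. c j k \<noteq> 0))"

definition fund_wt :: "'i \<Rightarrow> 'i weight" where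
  "fund_wt i = (\<lambda>k. if k = i then 1 else 0)"

definition simple_root :: "('i \<Rightarrow> 'i \<Rightarrow> int) \<Rightarrow> 'i \<Rightarrow> 'i weight" where
  "simple_root c j = (\<lambda>k. c k j)"

definition srefl :: "('i \<Rightarrow> 'i \<Rightarrow> int) \<Rightarrow> 'i \<Rightarrow> 'i weight \<Rightarrow> 'i weight" where
  "srefl c i lam = (\<lambda>k. lam k - lam i * simple_root c i k)"

definition word_act :: "('i \<Rightarrow> 'i \<Rightarrow> int) \<Rightarrow> 'i list \<Rightarrow> 'i weight \<Rightarrow> 'i weight" where
  "word_act c xs = foldr (\<lambda>i f. srefl c i \<circ> f) xs id"

definition weyl :: "('i \<Rightarrow> 'i \<Rightarrow> int) \<Rightarrow> ('i weight \<Rightarrow> 'i weight) set" where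
  "weyl c = range (word_act c)"

definition wlen :: "('i \<Rightarrow> 'i \<Rightarrow> int) \<Rightarrow> ('i weight \<Rightarrow> 'i weight) \<Rightarrow> nat" where
  "wlen c w = (LEAST n. \<exists>xs. length xs = n \<and> word_act c xs = w)"

definition chamber_weights :: "('i \<Rightarrow> 'i \<Rightarrow> int) \<Rightarrow> 'i weight set" where
  "chamber_weights c = {w (fund_wt i) | w i. w \<in> weyl c}"

definition edge_ineqs :: "('i::finite \<Rightarrow> 'i \<Rightarrow> int) \<Rightarrow> ('i weight \<Rightarrow> int) \<Rightarrow> bool" where
  "edge_ineqs c M \<longleftrightarrow>
     (\<forall>w\<in>weyl c. \<forall>i.
        M (w (fund_wt i)) + M ((w \<circ> srefl c i) (fund_wt i))
          + (\<Sum>k\<in>UNIV - {i}. c k i * M (w (fund_wt k))) \<le> 0)"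

text \<open>Tropical Pluecker relations at (w,i,j), with  N xs m = M_{w s_{xs} varpi_m}.
  Case c i j = c j i = -1 (type A2), case c i j = -2, c j i = -1 (type B2, i short),
  case c i j = -3, c j i = -1 (type G2, i short); for c i j = 0 there is no relation.\<close>
definition tpr_A2 :: "('i \<Rightarrow> 'i \<Rightarrow> int) \<Rightarrow> ('i weight \<Rightarrow> int) \<Rightarrow> ('i weight \<Rightarrow> 'i weight) \<Rightarrow> 'i \<Rightarrow> 'i \<Rightarrow> bool" where
  "tpr_A2 c M w i j \<longleftrightarrow> (let N = (\<lambda>xs m. M (w (word_act c xs (fund_wt m)))) in
   (N [j] j + N [i] i =
      min (N [] i + N [i,j] j) (N [] j + N [j,i] i)))"

definition tpr_B2 :: "('i \<Rightarrow> 'i \<Rightarrow> int) \<Rightarrow> ('i weight \<Rightarrow> int) \<Rightarrow> ('i weight \<Rightarrow> 'i weight) \<Rightarrow> 'i \<Rightarrow> 'i \<Rightarrow> bool" where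
  "tpr_B2 c M w i j \<longleftrightarrow> (let N = (\<lambda>xs m. M (w (word_act c xs (fund_wt m)))) in
   (N [j,i] i + N [i] i + N [i,j] j =
      min (2 * N [i] i + N [j,i,j] j) (min (N [] i + N [i,j] j + N [i,j,i] i) (N [] j + 2 * N [i,j,i] i))) \<and>
   (N [j] j + 2 * N [i] i + N [i,j] j =
      min (2 * N [] j + 2 * N [i,j,i] i) (min (N [] j + 2 * N [i] i + N [j,i,j] j) (2 * N [] i + 2 * N [i,j] j))))"

definition tpr_G2 :: "('i \<Rightarrow> 'i \<Rightarrow> int) \<Rightarrow> ('i weight \<Rightarrow> int) \<Rightarrow> ('i weight \<Rightarrow> 'i weight) \<Rightarrow> 'i \<Rightarrow> 'i \<Rightarrow> bool" where
  "tpr_G2 c M w i j \<longleftrightarrow> (let N = (\<lambda>xs m. M (w (word_act c xs (fund_wt m)))) in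
   (N [j,i] i + 2 * N [i] i + 2 * N [i,j] j + 3 * N [i,j,i] i + N [i,j,i,j] j =
      min (6 * N [i] i + 3 * N [i,j,i,j] j) (min (2 * N [] i + 2 * N [i,j] j + 4 * N [i,j,i] i + N [i,j,i,j] j) (min (2 * N [] j + 6 * N [i,j,i] i + N [i,j,i,j] j) (min (3 * N [i] i + 3 * N [i,j] j + 3 * N [i,j,i,j,i] i) (3 * N [i] i + 2 * N [i,j] j + 3 * N [i,j,i] i + N [j,i,j,i,j] j))))) \<and>
   (N [j,i,j,i] i + N [i] i + N [i,j] j + 2 * N [i,j,i] i + N [i,j,i,j] j =
      min (N [i] i + 2 * N [i,j] j + 3 * N [i,j,i,j,i] i) (min (3 * N [i] i + 2 * N [i,j,i,j] j + N [i,j,i,j,i] i) (min (N [i] i + N [i,j] j + 3 * N [i,j,i] i + N [j,i,j,i,j] j) (min (N [] j + 3 * N [i,j,i] i + N [i,j,i,j] j + N [i,j,i,j,i] i) (N [] i + N [i,j] j + 2 * N [i,j,i] i + N [i,j,i,j] j + N [i,j,i,j,i] i))))) \<and>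
   (N [j] j + 3 * N [i] i + 2 * N [i,j] j + 3 * N [i,j,i] i + N [i,j,i,j] j =
      min (3 * N [] i + 3 * N [i,j] j + 3 * N [i,j,i] i + N [i,j,i,j] j) (min (N [] j + 3 * N [i] i + 3 * N [i,j] j + 3 * N [i,j,i,j,i] i) (min (N [] j + 3 * N [i] i + 2 * N [i,j] j + 3 * N [i,j,i] i + N [j,i,j,i,j] j) (min (N [] j + 6 * N [i] i + 3 * N [i,j,i,j] j) (3 * N [] j + 6 * N [i,j,i] i + N [i,j,i,j] j))))) \<and>
   (N [j,i,j] j + 3 * N [i] i + 3 * N [i,j] j + 6 * N [i,j,i] i + 2 * N [i,j,i,j] j =
      min (3 * N [i] i + 4 * N [i,j] j + 6 * N [i,j,i] i + 2 * N [j,i,j,i,j] j) (min (9 * N [i] i + 6 * N [i,j,i,j] j) (min (3 * N [] j + 9 * N [i,j,i] i + 3 * N [i,j,i,j] j) (min (3 * N [] i + 3 * N [i,j] j + 6 * N [i,j,i] i + 3 * N [i,j,i,j] j) (3 * N [i] i + 6 * N [i,j] j + 6 * N [i,j,i,j,i] i))))))"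

definition trop_pluecker :: "('i \<Rightarrow> 'i \<Rightarrow> int) \<Rightarrow> ('i weight \<Rightarrow> int) \<Rightarrow> bool" where
  "trop_pluecker c M \<longleftrightarrow>
     (\<forall>w\<in>weyl c. \<forall>i j. i \<noteq> j \<and> wlen c w < wlen c (w \<circ> srefl c i) \<and> wlen c w < wlen c (w \<circ> srefl c j) \<longrightarrow>
        (c i j = -1 \<and> c j i = -1 \<longrightarrow> tpr_A2 c M w i j) \<and>
        (c i j = -2 \<and> c j i = -1 \<longrightarrow> tpr_B2 c M w i j) \<and>
        (c i j = -3 \<and> c j i = -1 \<longrightarrow> tpr_G2 c M w i j))"

text \<open>MV (= BZ) data: integer collections M_gamma (gamma in Gamma; values of M outside
  Gamma play no role) satisfying the edge inequalities and tropical Pluecker relations.\<close>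
definition mv_datum :: "('i::finite \<Rightarrow> 'i \<Rightarrow> int) \<Rightarrow> ('i weight \<Rightarrow> int) \<Rightarrow> bool" where
  "mv_datum c M \<longleftrightarrow> edge_ineqs c M \<and> trop_pluecker c M"

text \<open>Normalization mu_{w0} = 0, i.e. M_{w0 varpi_i} = 0 for all i (w0 = longest element).\<close>
definition mv_normalized :: "('i \<Rightarrow> 'i \<Rightarrow> int) \<Rightarrow> ('i weight \<Rightarrow> int) \<Rightarrow> bool" where
  "mv_normalized c M \<longleftrightarrow>
     (\<forall>w0\<in>weyl c. (\<forall>v\<in>weyl c. wlen c v \<le> wlen c w0) \<longrightarrow> (\<forall>i. M (w0 (fund_wt i)) = 0))"

definition kashiwara_f :: "('i::finite \<Rightarrow> 'i \<Rightarrow> int) \<Rightarrow> 'i \<Rightarrow> ('i weight \<Rightarrow> int) \<Rightarrow> ('i weight \<Rightarrow> int) \<Rightarrow> bool" where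
  "kashiwara_f c j M M' \<longleftrightarrow>
     mv_datum c M' \<and> M' (fund_wt j) = M (fund_wt j) - 1 \<and>
     (\<forall>w\<in>weyl c. \<forall>i. wlen c (srefl c j \<circ> w) < wlen c w \<longrightarrow> M' (w (fund_wt i)) = M (w (fund_wt i)))"

definition cj :: "('i \<Rightarrow> 'i \<Rightarrow> int) \<Rightarrow> ('i weight \<Rightarrow> int) \<Rightarrow> 'i \<Rightarrow> int" where
  "cj c M j = M (fund_wt j) - M (srefl c j (fund_wt j)) - 1"

end

theory Submission
  imports Defs
begin

text \<open>
  Write \<open>\<gamma> = v \<varpi>\<^sub>i\<close> and \<open>\<beta> = v\<^sup>-\<^sup>1 h\<^sub>j\<close>, a positive coroot whose \<open>h\<^sub>i\<close>-coefficient is the level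
  \<open>\<langle>h\<^sub>j, \<gamma>\<rangle> = 1\<close>.  Passing from \<open>M\<close> to \<open>M'\<close> changes nothing at levels \<open>\<le> 0\<close>.  The formula is
  known for \<open>\<gamma> = \<varpi>\<^sub>j\<close> and is propagated by tropical Pluecker relations in which only level one
  terms change, by induction on the height of \<open>\<beta>\<close>.  If \<open>\<beta> = h\<^sub>i\<close>, the rank two cosets meeting the
  wall of \<open>s\<^sub>j\<close> suffice.  Otherwise one may assume \<open>\<langle>\<beta>, \<alpha>\<^sub>k\<rangle> \<le> 0\<close> for \<open>k \<noteq> i\<close>; then
  \<open>\<beta> = h\<^sub>i + h\<^sub>k + \<dots>\<close> with \<open>c\<^sub>k\<^sub>i = -1\<close>, and either \<open>\<beta> = h\<^sub>i + h\<^sub>k\<close> lies in a subsystem of type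
  \<open>B\<^sub>2\<close> or \<open>G\<^sub>2\<close>, or a relation of type \<open>A\<^sub>2\<close> off the wall, together with its image under \<open>s\<^sub>j\<close>,
  reduces \<open>\<gamma>\<close> to two chamber weights with the smaller coroot \<open>\<beta> - h\<^sub>i\<close>.
\<close>

section \<open>Action of words on weights and coroots\<close>

lemma word_act_Nil [simp]: "word_act c [] = id"
  by (simp add: word_act_def)

lemma word_act_Cons: "word_act c (a # xs) lam = srefl c a (word_act c xs lam)"
  by (simp add: word_act_def)

lemma word_act_append: "word_act c (xs @ ys) lam = word_act c xs (word_act c ys lam)"
  by (induction xs) (simp_all add: word_act_Cons)

definition pair :: "('i::finite \<Rightarrow> int) \<Rightarrow> ('i \<Rightarrow> int) \<Rightarrow> int" where
  "pair x lam = (\<Sum>k\<in>UNIV. x k * lam k)"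

definition root_pair :: "('i::finite \<Rightarrow> 'i \<Rightarrow> int) \<Rightarrow> 'i \<Rightarrow> ('i \<Rightarrow> int) \<Rightarrow> int" where
  "root_pair c k x = (\<Sum>l\<in>UNIV. x l * c l k)"

definition lin_comb :: "int \<Rightarrow> ('i \<Rightarrow> int) \<Rightarrow> int \<Rightarrow> ('i \<Rightarrow> int) \<Rightarrow> 'i \<Rightarrow> int" where
  "lin_comb a x b y = (\<lambda>k. a * x k + b * y k)"

text \<open>Elements of the coroot lattice are written in the basis of simple coroots, so that
  \<open>h\<^sub>i\<close> has the same coordinates as \<open>\<varpi>\<^sub>i\<close> has as a weight and is also denoted \<open>fund_wt i\<close>.\<close>

definition coroot_refl :: "('i::finite \<Rightarrow> 'i \<Rightarrow> int) \<Rightarrow> 'i \<Rightarrow> ('i \<Rightarrow> int) \<Rightarrow> 'i \<Rightarrow> int" where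
  "coroot_refl c k x = lin_comb 1 x (- root_pair c k x) (fund_wt k)"

definition coroot_act :: "('i::finite \<Rightarrow> 'i \<Rightarrow> int) \<Rightarrow> 'i list \<Rightarrow> ('i \<Rightarrow> int) \<Rightarrow> 'i \<Rightarrow> int" where
  "coroot_act c xs = foldr (coroot_refl c) xs"

definition nonneg :: "('i \<Rightarrow> int) \<Rightarrow> bool" where
  "nonneg x \<longleftrightarrow> (\<forall>k. 0 \<le> x k)"

definition nonpos :: "('i \<Rightarrow> int) \<Rightarrow> bool" where
  "nonpos x \<longleftrightarrow> (\<forall>k. x k \<le> 0)"

lemma coroot_act_Nil [simp]: "coroot_act c [] x = x"
  by (simp add: coroot_act_def)

lemma coroot_act_Cons: "coroot_act c (a # xs) x = coroot_refl c a (coroot_act c xs x)"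
  by (simp add: coroot_act_def)

lemma coroot_act_append: "coroot_act c (xs @ ys) x = coroot_act c xs (coroot_act c ys x)"
  by (simp add: coroot_act_def)

lemma pair_fund_wt_left [simp]: "pair (fund_wt i) lam = lam i"
  by (simp add: pair_def fund_wt_def if_distrib [of "\<lambda>x. x * _"] cong: if_cong)

lemma pair_fund_wt_right [simp]: "pair x (fund_wt i) = x i"
  by (simp add: pair_def fund_wt_def if_distrib [of "\<lambda>x. _ * x"] cong: if_cong)

lemma root_pair_fund_wt [simp]: "root_pair c k (fund_wt i) = c i k"
  by (simp add: root_pair_def fund_wt_def if_distrib [of "\<lambda>x. x * _"] cong: if_cong)

lemma root_pair_lin_comb [simp]:
  "root_pair c k (lin_comb a x b y) = a * root_pair c k x + b * root_pair c k y"
  by (simp add: root_pair_def lin_comb_def sum.distrib sum_distrib_left algebra_simps)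

lemma coroot_refl_lin_comb:
  "coroot_refl c k (lin_comb a x b y) = lin_comb a (coroot_refl c k x) b (coroot_refl c k y)"
  unfolding coroot_refl_def root_pair_lin_comb by (rule ext) (simp add: lin_comb_def algebra_simps)

lemma coroot_act_lin_comb:
  "coroot_act c xs (lin_comb a x b y) = lin_comb a (coroot_act c xs x) b (coroot_act c xs y)"
  by (induction xs) (simp_all add: coroot_act_Cons coroot_refl_lin_comb)

lemma coroot_refl_other: "l \<noteq> k \<Longrightarrow> coroot_refl c k x l = x l"
  by (simp add: coroot_refl_def lin_comb_def fund_wt_def)

lemma nonneg_lin_comb: "nonneg x \<Longrightarrow> nonneg y \<Longrightarrow> 0 \<le> a \<Longrightarrow> 0 \<le> b \<Longrightarrow> nonneg (lin_comb a x b y)"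
  by (simp add: nonneg_def lin_comb_def)

lemma pair_coroot_refl:
  fixes c :: "'i::finite \<Rightarrow> 'i \<Rightarrow> int"
  shows "pair (coroot_refl c k x) lam = pair x (srefl c k lam)"
proof -
  have "pair (coroot_refl c k x) lam = (\<Sum>l\<in>UNIV. x l * lam l - root_pair c k x * (fund_wt k l * lam l))"
    by (simp add: pair_def coroot_refl_def lin_comb_def algebra_simps)
  also have "\<dots> = pair x lam - root_pair c k x * pair (fund_wt k) lam"
    by (simp add: pair_def sum_subtractf sum_distrib_left)
  also have "\<dots> = pair x (srefl c k lam)"
    by (subst pair_fund_wt_left) (simp add: pair_def root_pair_def srefl_def simple_root_def
        right_diff_distrib sum_subtractf sum_distrib_left mult_ac)
  finally show ?thesis .
qed

lemma pair_coroot_act: "pair (coroot_act c xs x) lam = pair x (word_act c (rev xs) lam)"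
  by (induction xs arbitrary: x lam)
    (simp_all add: coroot_act_Cons word_act_append word_act_Cons pair_coroot_refl)

lemma pair_word_act: "pair x (word_act c xs lam) = pair (coroot_act c (rev xs) x) lam"
  by (simp add: pair_coroot_act)

text \<open>Turns the level \<open><h_j, v varpi_i>\<close> into the \<open>h_i\<close>-coefficient
  of \<open>v^{-1} h_j\<close>, so that signs of coroots govern levels.\<close>

lemma word_act_fund_wt: "word_act c xs (fund_wt i) j = coroot_act c (rev xs) (fund_wt j) i"
  by (metis pair_word_act pair_fund_wt_left pair_fund_wt_right)

lemma wlen_le: "word_act c ys = w \<Longrightarrow> wlen c w \<le> length ys"
  unfolding wlen_def by (rule Least_le) blast

lemma wlen_witness: "\<exists>ys. length ys = wlen c (word_act c xs) \<and> word_act c ys = word_act c xs"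
  unfolding wlen_def by (rule LeastI_ex) blast

lemma word_act_snoc: "word_act c (xs @ [k]) = word_act c xs \<circ> srefl c k"
  by (rule ext) (simp add: word_act_append word_act_Cons)

section \<open>Finite Cartan data, inverse words and the invariant form\<close>

locale cartan =
  fixes c :: "'i::finite \<Rightarrow> 'i \<Rightarrow> int" and d :: "'i \<Rightarrow> real"
  assumes diag [simp]: "c i i = 2"
    and offdiag: "i \<noteq> k \<Longrightarrow> c i k \<le> 0"
    and zero_iff: "c i k = 0 \<longleftrightarrow> c k i = 0"
    and d_pos: "d i > 0"
    and symmetrizable: "d i * real_of_int (c i k) = d k * real_of_int (c k i)"
    and pos_def: "x \<noteq> (\<lambda>_. 0) \<Longrightarrow>
      (\<Sum>i\<in>UNIV. \<Sum>k\<in>UNIV. x i * d i * real_of_int (c i k) * x k) > 0"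
begin

abbreviation "word \<equiv> word_act c"
abbreviation "cact \<equiv> coroot_act c"
abbreviation "rp \<equiv> root_pair c"

lemma srefl_srefl [simp]: "srefl c k (srefl c k lam) = lam"
  by (rule ext) (simp add: srefl_def simple_root_def)

lemma coroot_refl_refl [simp]: "coroot_refl c k (coroot_refl c k x) = x"
  by (simp add: coroot_refl_def) (rule ext, simp add: lin_comb_def)

lemma word_rev [simp]: "word (rev xs) (word xs lam) = lam" "word xs (word (rev xs) lam) = lam"
  by (induction xs arbitrary: lam) (simp_all add: word_act_append word_act_Cons)

lemma cact_rev [simp]: "cact (rev xs) (cact xs x) = x" "cact xs (cact (rev xs) x) = x"
  by (induction xs arbitrary: x) (simp_all add: coroot_act_append coroot_act_Cons)

lemma word_rev_cong:
  assumes "word xs = word ys"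
  shows "word (rev xs) = word (rev ys)"
proof
  fix lam
  have "word (rev xs) lam = word (rev xs) (word ys (word (rev ys) lam))"
    by simp
  then show "word (rev xs) lam = word (rev ys) lam"
    by (simp only: assms [symmetric] word_rev)
qed

lemma cact_cong:
  assumes "word xs = word ys"
  shows "cact xs x = cact ys x"
proof
  fix k
  show "cact xs x k = cact ys x k"
    using pair_coroot_act [of c xs x "fund_wt k"] pair_coroot_act [of c ys x "fund_wt k"]
    by (simp add: word_rev_cong [OF assms])
qed

lemma word_cong:
  assumes "\<And>x. cact xs x = cact ys x"
  shows "word xs = word ys"
proof -
  have *: "cact (rev xs) x = cact (rev ys) x" for x
    by (metis assms cact_rev)
  show ?thesis
  proof (intro ext)
    fix lam k
    show "word xs lam k = word ys lam k"
      using pair_word_act [of "fund_wt k" c xs lam] pair_word_act [of "fund_wt k" c ys lam]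
      by (simp add: *)
  qed
qed

text \<open>The Weyl-invariant form on the coroot lattice with
  \<open>(h_k, x) = <x, alpha_k> / d k\<close>, hence \<open>(h_k, h_k) = 2 / d k\<close>. Division
  by \<open>d\<close> makes it symmetric because \<open>d\<close> symmetrizes the rows of
  \<open>c\<close>.\<close>

definition form :: "('i \<Rightarrow> int) \<Rightarrow> ('i \<Rightarrow> int) \<Rightarrow> real" where
  "form x y = (\<Sum>k\<in>UNIV. real_of_int (rp k x * y k) / d k)"

lemma sym_quot: "real_of_int (c i k) / d k = real_of_int (c k i) / d i"
  using symmetrizable [of i k] d_pos [of i] d_pos [of k] by (simp add: field_simps)

lemma form_sum: "form x y = (\<Sum>k\<in>UNIV. \<Sum>l\<in>UNIV. real_of_int (x l) * real_of_int (y k) * (real_of_int (c l k) / d k))"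
  by (simp add: form_def root_pair_def sum_distrib_left sum_divide_distrib mult_ac)

lemma form_commute: "form x y = form y x"
proof -
  have "form x y = (\<Sum>l\<in>UNIV. \<Sum>k\<in>UNIV. real_of_int (x l) * real_of_int (y k) * (real_of_int (c l k) / d k))"
    unfolding form_sum by (rule sum.swap)
  also have "\<dots> = form y x"
    unfolding form_sum by (intro sum.cong refl) (subst sym_quot, simp add: mult_ac)
  finally show ?thesis .
qed

lemma form_lin_comb_left [simp]: "form (lin_comb a x b y) z = a * form x z + b * form y z"
  by (simp add: form_def sum_distrib_left sum.distrib [symmetric] add_divide_distrib algebra_simps)

lemma form_lin_comb_right [simp]: "form z (lin_comb a x b y) = a * form z x + b * form z y"
  by (simp add: form_commute [of z])

lemma form_fund_wt_right [simp]: "form x (fund_wt k) = rp k x / d k"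
  by (simp add: form_def fund_wt_def if_distrib [of "\<lambda>x. _ * x"] if_distrib [of "\<lambda>x. x / _"]
      if_distrib [of real_of_int] cong: if_cong)

lemma form_fund_wt_left [simp]: "form (fund_wt k) x = rp k x / d k"
  by (simp add: form_commute [of "fund_wt k"])

lemma form_pos:
  assumes "x k \<noteq> 0"
  shows "form x x > 0"
proof -
  \<comment> \<open>The rescaling \<open>x i / d i\<close> carries the form of
    \<open>pos_def\<close> to \<open>form\<close>.\<close>
  have "(\<Sum>i\<in>UNIV. \<Sum>k\<in>UNIV. (x i / d i) * d i * real_of_int (c i k) * (x k / d k)) > 0"
    using assms d_pos [of k] by (intro pos_def) (auto simp: fun_eq_iff intro!: exI [of _ k])
  also have "(\<Sum>i\<in>UNIV. \<Sum>k\<in>UNIV. (x i / d i) * d i * real_of_int (c i k) * (x k / d k)) =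
      (\<Sum>i\<in>UNIV. \<Sum>k\<in>UNIV. real_of_int (x i) * real_of_int (x k) * (real_of_int (c i k) / d k))"
    using d_pos by (intro sum.cong refl) (simp add: less_imp_neq [THEN not_sym] field_simps)
  also have "\<dots> = form x x"
    unfolding form_sum by (rule sum.swap)
  finally show ?thesis .
qed

lemma form_coroot_refl: "form (coroot_refl c k x) (coroot_refl c k y) = form x y"
  by (simp add: coroot_refl_def form_commute [of "fund_wt k"] field_simps)

lemma form_cact [simp]: "form (cact xs x) (cact xs y) = form x y"
  by (induction xs) (simp_all add: coroot_act_Cons form_coroot_refl)

lemma cact_nonzero: "\<exists>l. cact xs (fund_wt k) l \<noteq> 0"
proof (rule ccontr)
  assume "\<nexists>l. cact xs (fund_wt k) l \<noteq> 0"
  then have "form (cact xs (fund_wt k)) (cact xs (fund_wt k)) = 0"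
    by (simp only: form_def) simp
  then show False
    using d_pos [of k] by simp
qed

lemma nonneg_nonpos_contr: "nonneg (cact xs (fund_wt k)) \<Longrightarrow> nonpos (cact xs (fund_wt k)) \<Longrightarrow> False"
  using cact_nonzero [of xs k] by (metis nonneg_def nonpos_def order_antisym)

lemma coroot_refl_self: "coroot_refl c k (fund_wt k) = (\<lambda>l. - fund_wt k l)"
  by (simp add: coroot_refl_def lin_comb_def)

lemma cact_uminus: "cact xs (\<lambda>l. - x l) = (\<lambda>l. - cact xs x l)"
  using coroot_act_lin_comb [of c xs "-1" x 0 x] by (simp add: lin_comb_def)

lemma cact_snoc_self: "cact (xs @ [k]) (fund_wt k) = (\<lambda>l. - cact xs (fund_wt k) l)"
  by (simp add: coroot_act_append coroot_act_Cons coroot_refl_self cact_uminus)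

text \<open>A simple reflection \<open>s_a\<close> alters only the \<open>a\<close>-coordinate, so a
  sign flip leaves a multiple of \<open>h_a\<close>. Pulling it back to \<open>h_k\<close> shows
  that the nonnegative integer multiple divides 1.\<close>

lemma flipped_coroot_simple:
  assumes pos: "nonneg (cact zs (fund_wt k))"
    and neg: "nonpos (coroot_refl c a (cact zs (fund_wt k)))"
  shows "cact zs (fund_wt k) = fund_wt a"
proof -
  define x where "x = cact zs (fund_wt k)"
  have "x l = 0" if "l \<noteq> a" for l
    using that pos neg coroot_refl_other [OF that, of c x] unfolding x_def nonneg_def nonpos_def
    by (metis order_antisym)
  then have x: "x = lin_comb (x a) (fund_wt a) 0 (fund_wt a)"
    by (auto simp: lin_comb_def fund_wt_def)
  have "fund_wt k = cact (rev zs) x"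
    by (simp add: x_def)
  then have "fund_wt k = lin_comb (x a) (cact (rev zs) (fund_wt a)) 0 (cact (rev zs) (fund_wt a))"
    using x coroot_act_lin_comb by metis
  then have "fund_wt k k = x a * cact (rev zs) (fund_wt a) k"
    by (simp add: lin_comb_def)
  then have "x a * cact (rev zs) (fund_wt a) k = 1"
    by (simp add: fund_wt_def)
  moreover have "x a \<ge> 0"
    using pos by (simp add: x_def nonneg_def)
  ultimately have "x a = 1"
    by (metis pos_zmult_eq_1_iff zero_neq_one mult_zero_left order_le_less)
  then show ?thesis
    using x by (simp add: x_def [symmetric]) (simp add: lin_comb_def)
qed

text \<open>The conjugate of \<open>s_k\<close> by \<open>zs\<close> is the reflection in
  \<open>zs h_k\<close>, by invariance of the form; equality of norms gives
  \<open>d k = d a\<close>.\<close>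

lemma word_conj:
  assumes "cact zs (fund_wt k) = fund_wt a"
  shows "word (zs @ [k]) = word (a # zs)"
proof (rule word_cong)
  fix x
  have dk: "d k = d a"
    using form_cact [of zs "fund_wt k" "fund_wt k"] assms d_pos [of k] d_pos [of a]
    by (simp add: field_simps)
  have "rp a (cact zs x) / d a = form (cact zs x) (fund_wt a)"
    by simp
  also have "\<dots> = rp k x / d k"
    by (simp flip: assms)
  finally have "rp a (cact zs x) = rp k x"
    using dk d_pos [of k] by simp
  then show "cact (zs @ [k]) x = cact (a # zs) x"
    by (simp add: coroot_act_append coroot_act_Cons coroot_refl_def coroot_act_lin_comb assms)
qed

section \<open>Sign coherence of coroots and the length function\<close>

text \<open>Bounded by word length because sign coherence and the exchange condition are proved
  together: the exchange condition up to length \<open>n\<close> yields coherence at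
  \<open>Suc n\<close>.\<close>

definition sign_coherent :: "nat \<Rightarrow> bool" where
  "sign_coherent n \<longleftrightarrow>
    (\<forall>xs k. length xs \<le> n \<longrightarrow> nonneg (cact xs (fund_wt k)) \<or> nonpos (cact xs (fund_wt k)))"

text \<open>Outer letters are peeled off until \<open>zs h_k\<close> is positive and
  \<open>s_a zs h_k\<close> negative. Then \<open>zs h_k = h_a\<close>, hence
  \<open>zs s_k = s_a zs\<close>, and the letter \<open>a\<close> cancels.\<close>

lemma exchange_aux:
  assumes "sign_coherent (length xs)" "nonpos (cact xs (fund_wt k))"
  shows "\<exists>ys. Suc (length ys) = length xs \<and> word (xs @ [k]) = word ys"
  using assms
proof (induction xs)
  case Nil
  then have "fund_wt k k \<le> (0 :: int)"
    by (simp add: nonpos_def)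
  then show ?case by (simp add: fund_wt_def)
next
  case (Cons a zs)
  have coh: "sign_coherent (length zs)"
    using Cons.prems(1) by (simp add: sign_coherent_def)
  show ?case
  proof (cases "nonpos (cact zs (fund_wt k))")
    case True
    then obtain ys where "Suc (length ys) = length zs" "word (zs @ [k]) = word ys"
      using Cons.IH coh by blast
    then show ?thesis
      by (intro exI [of _ "a # ys"]) (auto simp: word_act_Cons)
  next
    case False
    then have "nonneg (cact zs (fund_wt k))"
      using coh by (auto simp: sign_coherent_def)
    then have "cact zs (fund_wt k) = fund_wt a"
      using Cons.prems(2) by (intro flipped_coroot_simple) (simp_all add: coroot_act_Cons)
    then have "word (zs @ [k]) lam = word (a # zs) lam" for lam
      by (simp only: word_conj)
    then show ?thesis
      by (intro exI [of _ zs]) (auto simp: word_act_Cons)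
  qed
qed

lemma cartan_rank2_cases:
  assumes "i \<noteq> k"
  shows "(c i k, c k i) \<in> {(0,0), (-1,-1), (-2,-1), (-1,-2), (-3,-1), (-1,-3)}"
proof -
  \<comment> \<open>Twice the component of \<open>h_i\<close> orthogonal to \<open>h_k\<close>; its
    positive norm is the bound \<open>c i k * c k i < 4\<close>.\<close>
  define x where "x = lin_comb 2 (fund_wt i) (- c i k) (fund_wt k)"
  have "x i = 2"
    using assms by (simp add: x_def lin_comb_def fund_wt_def)
  then have "form x x > 0"
    by (intro form_pos [of x i]) simp
  moreover have "form x x = 2 * (4 - real_of_int (c i k) * real_of_int (c k i)) / d i"
    using sym_quot [of i k] by (simp add: x_def field_simps)
  ultimately have "real_of_int (c i k * c k i) < 4"
    using d_pos [of i] by (simp add: zero_less_divide_iff)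
  then have prod: "c i k * c k i < 4"
    by linarith
  have le: "c i k \<le> 0" "c k i \<le> 0"
    using assms offdiag by auto
  show ?thesis
  proof (cases "c i k = 0")
    case True
    then show ?thesis using zero_iff by simp
  next
    case False
    then have lt: "c i k \<le> -1" "c k i \<le> -1"
      using le zero_iff [of i k] by auto
    have "- c i k \<le> c i k * c k i" "- c k i \<le> c i k * c k i"
      using mult_mono [of 1 "- c k i" "- c i k" "- c i k"] mult_mono [of 1 "- c i k" "- c k i" "- c k i"] lt
      by (simp_all add: mult_ac)
    then have "c i k \<in> {-1,-2,-3}" "c k i \<in> {-1,-2,-3}"
      using prod lt by auto
    then show ?thesis
      using prod by auto
  qed
qed

text \<open>\<open>R\<close> stands for the positive coroots of a rank two subsystem, as pairs of coefficients.\<close>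

definition rank2_positive :: "'i \<Rightarrow> 'i \<Rightarrow> (int \<times> int) set \<Rightarrow> bool" where
  "rank2_positive i k R \<longleftrightarrow> (1, 0) \<in> R \<and> (0, 1) \<in> R \<and>
    (\<forall>a b. (a, b) \<in> R \<longrightarrow> 0 \<le> a \<and> 0 \<le> b \<and>
      ((a, b) = (1, 0) \<or> (- a - c k i * b, b) \<in> R) \<and>
      ((a, b) = (0, 1) \<or> (a, - b - c i k * a) \<in> R))"

lemma rank2_coroots:
  assumes "i \<noteq> k"
  shows "\<exists>R. rank2_positive i k R"
proof -
  consider "c i k = 0" "c k i = 0"
    | "c i k = -1" "c k i = -1"
    | "c i k = -2" "c k i = -1"
    | "c i k = -1" "c k i = -2"
    | "c i k = -3" "c k i = -1"
    | "c i k = -1" "c k i = -3"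
    using cartan_rank2_cases [OF assms] by auto
  then show ?thesis
  proof cases
    case 1
    then show ?thesis by (intro exI [of _ "{(1,0),(0,1)}"]) (auto simp: rank2_positive_def)
  next
    case 2
    then show ?thesis by (intro exI [of _ "{(1,0),(0,1),(1,1)}"]) (auto simp: rank2_positive_def)
  next
    case 3
    then show ?thesis by (intro exI [of _ "{(1,0),(0,1),(1,1),(1,2)}"]) (auto simp: rank2_positive_def)
  next
    case 4
    then show ?thesis by (intro exI [of _ "{(1,0),(0,1),(1,1),(2,1)}"]) (auto simp: rank2_positive_def)
  next
    case 5
    then show ?thesis by (intro exI [of _ "{(1,0),(0,1),(1,1),(1,2),(1,3),(2,3)}"]) (auto simp: rank2_positive_def)
  next
    case 6
    then show ?thesis by (intro exI [of _ "{(1,0),(0,1),(1,1),(2,1),(3,1),(3,2)}"]) (auto simp: rank2_positive_def)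
  qed
qed

lemma coroot_refl_pair_left:
  "coroot_refl c i (lin_comb a (fund_wt i) b (fund_wt k)) = lin_comb (- a - c k i * b) (fund_wt i) b (fund_wt k)"
  by (simp add: coroot_refl_def) (rule ext, simp add: lin_comb_def algebra_simps)

lemma coroot_refl_pair_right:
  "coroot_refl c k (lin_comb a (fund_wt i) b (fund_wt k)) = lin_comb a (fund_wt i) (- b - c i k * a) (fund_wt k)"
  by (simp add: coroot_refl_def) (rule ext, simp add: lin_comb_def algebra_simps)

lemma sign_coherent_all: "sign_coherent n"
proof (induction n)
  case 0
  then show ?case by (simp add: sign_coherent_def nonneg_def fund_wt_def)
next
  case (Suc n)
  note coh = Suc.IH
  \<comment> \<open>If \<open>v\<close> keeps both \<open>h_i\<close> and \<open>h_k\<close>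
    positive, all positive combinations stay positive. Otherwise exchange shortens \<open>v\<close>
    by a letter \<open>l\<close>, and \<open>s_l\<close> keeps the coroot in \<open>R\<close> unless
    it is \<open>h_l\<close> itself.\<close>
  have rank2: "nonneg (cact v (lin_comb a (fund_wt i) b (fund_wt k))) \<or>
               nonpos (cact v (lin_comb a (fund_wt i) b (fund_wt k)))"
    if R: "rank2_positive i k R"
      and "(a, b) \<in> R" "length v \<le> n" for R a b v i k
    using that(2,3)
  proof (induction "length v" arbitrary: v a b rule: less_induct)
    case less
    have step: "?case" if neg: "nonpos (cact v (fund_wt l))"
      and y: "coroot_refl c l (lin_comb a (fund_wt i) b (fund_wt k)) = lin_comb a' (fund_wt i) b' (fund_wt k)"
      and R': "(a', b') \<in> R" for l a' b'
    proof -
      have "sign_coherent (length v)"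
        using coh less.prems(2) by (auto simp: sign_coherent_def)
      then obtain ys where ys: "Suc (length ys) = length v" "word (v @ [l]) = word ys"
        using exchange_aux neg by blast
      have "cact v (lin_comb a (fund_wt i) b (fund_wt k)) = cact (v @ [l]) (lin_comb a' (fund_wt i) b' (fund_wt k))"
        unfolding coroot_act_append y [symmetric] by (simp add: coroot_act_Cons)
      also have "\<dots> = cact ys (lin_comb a' (fund_wt i) b' (fund_wt k))"
        by (rule cact_cong [OF ys(2)])
      finally show ?thesis
        using less.hyps [of ys] ys(1) R' less.prems(2) by simp
    qed
    have "nonneg (cact v (fund_wt l)) \<or> nonpos (cact v (fund_wt l))" for l
      using coh less.prems(2) by (auto simp: sign_coherent_def)
    then consider "(a, b) = (1, 0)" | "(a, b) = (0, 1)"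
      | "nonneg (cact v (fund_wt i))" "nonneg (cact v (fund_wt k))"
      | "nonpos (cact v (fund_wt i))" "(a, b) \<noteq> (1, 0)"
      | "nonpos (cact v (fund_wt k))" "(a, b) \<noteq> (0, 1)"
      by blast
    then show ?case
    proof cases
      case 1
      then show ?thesis
        using coh less.prems(2) by (simp add: lin_comb_def sign_coherent_def)
    next
      case 2
      then show ?thesis
        using coh less.prems(2) by (simp add: lin_comb_def sign_coherent_def)
    next
      case 3
      then show ?thesis
        using R less.prems(1) unfolding rank2_positive_def by (simp add: coroot_act_lin_comb nonneg_lin_comb)
    next
      case 4
      then show ?thesis
        using R less.prems(1) unfolding rank2_positive_def by (intro step [OF _ coroot_refl_pair_left]) auto
    next
      case 5
      then show ?thesis
        using R less.prems(1) unfolding rank2_positive_def by (intro step [OF _ coroot_refl_pair_right]) auto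
    qed
  qed
  show ?case
    unfolding sign_coherent_def
  proof (intro allI impI)
    fix xs :: "'i list" and i
    assume len: "length xs \<le> Suc n"
    show "nonneg (cact xs (fund_wt i)) \<or> nonpos (cact xs (fund_wt i))"
    proof (cases xs rule: rev_cases)
      case Nil
      then show ?thesis by (simp add: nonneg_def fund_wt_def)
    next
      case (snoc zs k)
      have zs: "length zs \<le> n" using len snoc by simp
      show ?thesis
      proof (cases "i = k")
        case True
        then have "cact xs (fund_wt i) = (\<lambda>l. - cact zs (fund_wt i) l)"
          using snoc by (simp add: cact_snoc_self)
        then show ?thesis
          using coh zs by (auto simp: sign_coherent_def nonneg_def nonpos_def)
      next
        case False
        obtain R where R: "rank2_positive i k R"
          using rank2_coroots [OF False] by blast
        then have "(1, - c i k) \<in> R"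
          unfolding rank2_positive_def by (elim conjE allE [of _ 1] allE [of _ 0]) simp
        note rank2 [OF R this zs]
        moreover have "cact xs (fund_wt i) = cact zs (lin_comb 1 (fund_wt i) (- c i k) (fund_wt k))"
          using snoc by (simp add: coroot_act_append coroot_act_Cons coroot_refl_def)
        ultimately show ?thesis by simp
      qed
    qed
  qed
qed

theorem coroot_sign: "nonneg (cact xs (fund_wt k)) \<or> nonpos (cact xs (fund_wt k))"
  using sign_coherent_all [of "length xs"] by (auto simp: sign_coherent_def)

section \<open>Exchange, length and descent\<close>

lemma exchange:
  assumes "nonpos (cact xs (fund_wt k))"
  obtains ys where "Suc (length ys) = length xs" "word (xs @ [k]) = word ys"
  using exchange_aux [OF sign_coherent_all assms] by blast

lemma wlen_descent:
  assumes "nonpos (cact xs (fund_wt k))"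
  shows "wlen c (word (xs @ [k])) < wlen c (word xs)"
proof -
  obtain zs where zs: "length zs = wlen c (word xs)" "word zs = word xs"
    using wlen_witness by blast
  have "nonpos (cact zs (fund_wt k))"
    using assms cact_cong [OF zs(2)] by simp
  then obtain ys where "Suc (length ys) = length zs" "word (zs @ [k]) = word ys"
    by (rule exchange)
  then show ?thesis
    using zs wlen_le [of c ys "word (xs @ [k])"] by (simp add: word_act_snoc)
qed

text \<open>Supplies the length conditions of \<open>trop_pluecker\<close> from positivity of
  coroots.\<close>

lemma wlen_ascent:
  assumes "nonneg (cact xs (fund_wt k))"
  shows "wlen c (word xs) < wlen c (word xs \<circ> srefl c k)"
proof -
  have "nonpos (cact (xs @ [k]) (fund_wt k))"
    using assms by (simp add: cact_snoc_self nonpos_def nonneg_def)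
  moreover have "word ((xs @ [k]) @ [k]) = word xs"
    by (rule ext) (simp add: word_act_append word_act_Cons)
  ultimately show ?thesis
    using wlen_descent [of "xs @ [k]" k] by (simp only: word_act_snoc [of c xs])
qed

lemma wlen_rev: "wlen c (word (rev xs)) = wlen c (word xs)"
proof -
  have "wlen c (word (rev zs)) \<le> wlen c (word zs)" for zs
  proof -
    obtain ys where ys: "length ys = wlen c (word zs)" "word ys = word zs"
      using wlen_witness by blast
    show ?thesis
      using wlen_le [OF word_rev_cong [OF ys(2)]] ys(1) by simp
  qed
  from this [of xs] this [of "rev xs"] show ?thesis by simp
qed

text \<open>Supplies the condition under which \<open>kashiwara_f\<close> keeps the values of
  \<open>M\<close>.\<close>

lemma wlen_left_descent:
  assumes "nonpos (cact (rev xs) (fund_wt j))"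
  shows "wlen c (srefl c j \<circ> word xs) < wlen c (word xs)"
proof -
  have "word (j # xs) = srefl c j \<circ> word xs"
    by (rule ext) (simp add: word_act_Cons)
  then show ?thesis
    using wlen_descent [OF assms] wlen_rev [of "j # xs"] wlen_rev [of xs] by simp
qed

text \<open>One step towards the minimal element of a coset: \<open>u\<close> represents
  \<open>v s_i\<close>. The length equation serves inductions on words.\<close>

lemma descend:
  assumes "nonpos (cact v (fund_wt i))"
  obtains u where "Suc (length u) = length v" "nonneg (cact u (fund_wt i))"
    "\<And>lam. word v lam = word u (srefl c i lam)" "\<And>x. cact v x = cact u (coroot_refl c i x)"
proof -
  obtain u where u: "Suc (length u) = length v" "word (v @ [i]) = word u"
    using exchange [OF assms] by blast
  have "cact u x = cact v (coroot_refl c i x)" for x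
    using cact_cong [OF u(2)] by (simp add: coroot_act_append coroot_act_Cons)
  moreover have "nonneg (cact (v @ [i]) (fund_wt i))"
    using assms by (simp add: cact_snoc_self nonneg_def nonpos_def)
  then have "nonneg (cact u (fund_wt i))"
    using cact_cong [OF u(2)] by simp
  moreover have "word v lam = word u (srefl c i lam)" for lam
    by (simp add: word_act_append word_act_Cons flip: u(2))
  ultimately show ?thesis
    using u(1) by (intro that [of u]) auto
qed

lemma cact_eq_simple_nonneg: "cact v x = fund_wt j \<Longrightarrow> nonneg (cact v x)"
  by (simp add: nonneg_def fund_wt_def)

text \<open>Were \<open>v h_i\<close> positive too, \<open>h_j\<close> would be a sum of two nonzero
  nonnegative vectors with coefficients at least 1. This forces the successive descents inside rank
  two cosets.\<close>

lemma simple_coroot_indecomposable: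
  assumes "cact v (lin_comb a (fund_wt i) b (fund_wt k)) = fund_wt j" "1 \<le> a" "1 \<le> b"
    and pos: "nonneg (cact v (fund_wt k))"
  shows "nonpos (cact v (fund_wt i))"
proof (rule ccontr)
  assume "\<not> nonpos (cact v (fund_wt i))"
  then have pos': "nonneg (cact v (fund_wt i))"
    using coroot_sign by blast
  define x y where "x = cact v (fund_wt i)" and "y = cact v (fund_wt k)"
  have xy: "0 \<le> x l" "0 \<le> y l" for l
    using pos pos' by (simp_all add: x_def y_def nonneg_def)
  have sum: "a * x l + b * y l = fund_wt j l" for l
    using fun_cong [OF assms(1), of l] by (simp add: coroot_act_lin_comb x_def y_def) (simp add: lin_comb_def)
  have le: "x l \<le> a * x l" "y l \<le> b * y l" for l
    using mult_right_mono [OF assms(2) xy(1) [of l]] mult_right_mono [OF assms(3) xy(2) [of l]] by simp_all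
  obtain l m where "x l \<noteq> 0" "y m \<noteq> 0"
    using cact_nonzero [of v i] cact_nonzero [of v k] by (auto simp: x_def y_def)
  moreover have "x n = 0" "y n = 0" if "n \<noteq> j" for n
    using le [of n] xy [of n] sum [of n] that by (auto simp: fund_wt_def)
  ultimately have "x j \<noteq> 0" "y j \<noteq> 0"
    by metis+
  moreover have "a * x j + b * y j = 1"
    by (simp add: sum) (simp add: fund_wt_def)
  ultimately show False
    using le [of j] xy [of j] by linarith
qed

end

section \<open>Tropical Pluecker relations in rank two\<close>

text \<open>The rank two Pluecker relations express the values along one of the two reduced words of the
  longest element (\<open>P\<close>, \<open>Q\<close>: weights of type \<open>p\<close>, \<open>q\<close>) through those along the other one
  (\<open>R\<close>: its interior).  The two words are exchanged by \<open>w\<^sub>0\<close>, and tropically inverting the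
  relations amounts to applying this symmetry.\<close>

lemma pluecker_B2_inverse:
  fixes P0 P1 P2 Q0 Q1 Q3 R1 R2 :: int
  assumes "R2 + P1 + Q1 = min (2 * P1 + Q3) (min (P0 + Q1 + P2) (Q0 + 2 * P2))"
    and "R1 + 2 * P1 + Q1 = min (2 * Q0 + 2 * P2) (min (Q0 + 2 * P1 + Q3) (2 * P0 + 2 * Q1))"
  shows "P1 + R2 + R1 = min (2 * R2 + Q0) (min (P2 + R1 + P0) (Q3 + 2 * P0))"
    and "Q1 + 2 * R2 + R1 = min (2 * Q3 + 2 * P0) (min (Q3 + 2 * R2 + Q0) (2 * P2 + 2 * R1))"
  using assms by linarith+

text \<open>Splitting a minimum into five bounds and an attained value leaves linear arithmetic with
  one disjunction per relation.\<close>

lemma eq_min5D: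
  fixes x :: "'a :: linorder"
  assumes "x = min a (min b (min c (min d e)))"
  shows "x \<le> a" "x \<le> b" "x \<le> c" "x \<le> d" "x \<le> e" "x = a \<or> x = b \<or> x = c \<or> x = d \<or> x = e"
  using assms by (auto simp: min_def)

lemma eq_min5I:
  fixes x :: "'a :: linorder"
  assumes "x \<le> a" "x \<le> b" "x \<le> c" "x \<le> d" "x \<le> e" "x = a \<or> x = b \<or> x = c \<or> x = d \<or> x = e"
  shows "x = min a (min b (min c (min d e)))"
  using assms by (auto simp: min_def)

lemma pluecker_G2_inverse:
  fixes P0 P1 P2 P3 Q0 Q1 Q2 Q3 R1 R2 R3 R4 :: int
  assumes "R2 + 2 * P1 + 2 * Q1 + 3 * P2 + Q2 = min (6 * P1 + 3 * Q2) (min (2 * P0 + 2 * Q1 + 4 * P2 + Q2)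
      (min (2 * Q0 + 6 * P2 + Q2) (min (3 * P1 + 3 * Q1 + 3 * P3) (3 * P1 + 2 * Q1 + 3 * P2 + Q3))))"
    and "R4 + P1 + Q1 + 2 * P2 + Q2 = min (P1 + 2 * Q1 + 3 * P3) (min (3 * P1 + 2 * Q2 + P3)
      (min (P1 + Q1 + 3 * P2 + Q3) (min (Q0 + 3 * P2 + Q2 + P3) (P0 + Q1 + 2 * P2 + Q2 + P3))))"
    and "R1 + 3 * P1 + 2 * Q1 + 3 * P2 + Q2 = min (3 * P0 + 3 * Q1 + 3 * P2 + Q2) (min (Q0 + 3 * P1 + 3 * Q1 + 3 * P3)
      (min (Q0 + 3 * P1 + 2 * Q1 + 3 * P2 + Q3) (min (Q0 + 6 * P1 + 3 * Q2) (3 * Q0 + 6 * P2 + Q2))))"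
    and "R3 + 3 * P1 + 3 * Q1 + 6 * P2 + 2 * Q2 = min (3 * P1 + 4 * Q1 + 6 * P2 + 2 * Q3) (min (9 * P1 + 6 * Q2)
      (min (3 * Q0 + 9 * P2 + 3 * Q2) (min (3 * P0 + 3 * Q1 + 6 * P2 + 3 * Q2) (3 * P1 + 6 * Q1 + 6 * P3))))"
  shows "P1 + R4 + R3 + 2 * R2 + R1 = min (R4 + 2 * R3 + 3 * P0) (min (3 * R4 + 2 * R1 + P0)
      (min (Q3 + 3 * R2 + R1 + P0) (min (P3 + R3 + 2 * R2 + R1 + P0) (R4 + R3 + 3 * R2 + Q0))))"
    and "P2 + 2 * R4 + 2 * R3 + 3 * R2 + R1 = min (6 * R4 + 3 * R1) (min (2 * P3 + 2 * R3 + 4 * R2 + R1)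
      (min (2 * Q3 + 6 * R2 + R1) (min (3 * R4 + 3 * R3 + 3 * P0) (3 * R4 + 2 * R3 + 3 * R2 + Q0))))"
    and "Q2 + 3 * R4 + 2 * R3 + 3 * R2 + R1 = min (3 * P3 + 3 * R3 + 3 * R2 + R1) (min (Q3 + 3 * R4 + 3 * R3 + 3 * P0)
      (min (Q3 + 6 * R4 + 3 * R1) (min (3 * Q3 + 6 * R2 + R1) (Q3 + 3 * R4 + 2 * R3 + 3 * R2 + Q0))))"
proof -
  note rel = assms [THEN eq_min5D(1)] assms [THEN eq_min5D(2)] assms [THEN eq_min5D(3)]
    assms [THEN eq_min5D(4)] assms [THEN eq_min5D(5)] assms [THEN eq_min5D(6)]
  show "P1 + R4 + R3 + 2 * R2 + R1 = min (R4 + 2 * R3 + 3 * P0) (min (3 * R4 + 2 * R1 + P0)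
      (min (Q3 + 3 * R2 + R1 + P0) (min (P3 + R3 + 2 * R2 + R1 + P0) (R4 + R3 + 3 * R2 + Q0))))"
    by (rule eq_min5I) (use rel in \<open>smt (z3)\<close>)+
  show "P2 + 2 * R4 + 2 * R3 + 3 * R2 + R1 = min (6 * R4 + 3 * R1) (min (2 * P3 + 2 * R3 + 4 * R2 + R1)
      (min (2 * Q3 + 6 * R2 + R1) (min (3 * R4 + 3 * R3 + 3 * P0) (3 * R4 + 2 * R3 + 3 * R2 + Q0))))"
    by (rule eq_min5I) (use rel in \<open>smt (z3)\<close>)+
  show "Q2 + 3 * R4 + 2 * R3 + 3 * R2 + R1 = min (3 * P3 + 3 * R3 + 3 * R2 + R1) (min (Q3 + 3 * R4 + 3 * R3 + 3 * P0)
      (min (Q3 + 6 * R4 + 3 * R1) (min (3 * Q3 + 6 * R2 + R1) (Q3 + 3 * R4 + 2 * R3 + 3 * R2 + Q0))))"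
    by (rule eq_min5I) (use rel in \<open>smt (z3)\<close>)+
qed

text \<open>Only the left side and the last term \<open>e\<close> change. From
  \<open>e' = min e (e + z - v)\<close> follows \<open>l' = min l (e + z - v)\<close>, and the
  difference is carried over from \<open>l\<close> to \<open>x\<close>.\<close>

lemma min_shift:
  fixes x :: int
  assumes "l = min a (min b (min c (min d e)))" "l' = min a (min b (min c (min d e')))"
    and "v' = min v z" "l' - l = x' - x" "e' - e = v' - v" "y - x = z + e - v - l"
  shows "x' = min x y"
  using assms by (smt (verit))

section \<open>Values of \<open>M'\<close> at nonpositive level and at
  \<open>varpi_j\<close>\<close>

locale kashiwara = cartan c d for c :: "'i::finite \<Rightarrow> 'i \<Rightarrow> int" and d +
  fixes M M' :: "'i weight \<Rightarrow> int" and j :: 'i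
  assumes trop_M: "trop_pluecker c M"
    and kashiwara: "kashiwara_f c j M M'"
begin

lemma trop_M': "trop_pluecker c M'"
  using kashiwara by (simp add: kashiwara_f_def mv_datum_def)

text \<open>The formula conjectured by Anderson and Mirkovic, who did not restrict the level.\<close>

definition am :: "'i weight \<Rightarrow> bool" where
  "am lam \<longleftrightarrow> M' lam = min (M lam) (M (srefl c j lam) + cj c M j)"

lemma word_weyl [simp]: "word xs \<in> weyl c"
  by (simp add: weyl_def)

lemma srefl_fund_wt_other [simp]: "k \<noteq> i \<Longrightarrow> srefl c k (fund_wt i) = fund_wt i"
  by (rule ext) (simp add: srefl_def fund_wt_def)

lemma srefl_fixed: "lam k = 0 \<Longrightarrow> srefl c k lam = lam"
  by (rule ext) (simp add: srefl_def)

text \<open>If \<open>v^{-1} h_j\<close> is negative, then \<open>s_j v < v\<close> and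
  \<open>kashiwara_f\<close> applies. If it is positive and the level is 0, then \<open>s_j\<close>
  fixes the weight, and \<open>s_j v\<close> represents it instead.\<close>

lemma unchanged:
  assumes "word xs (fund_wt i) j \<le> 0"
  shows "M' (word xs (fund_wt i)) = M (word xs (fund_wt i))"
proof -
  have *: "M' (word ys (fund_wt i)) = M (word ys (fund_wt i))"
    if "nonpos (cact (rev ys) (fund_wt j))" for ys
    using kashiwara wlen_left_descent [OF that] by (simp add: kashiwara_f_def)
  show ?thesis
  proof (cases "nonpos (cact (rev xs) (fund_wt j))")
    case True
    then show ?thesis by (rule *)
  next
    case False
    then have nonneg: "nonneg (cact (rev xs) (fund_wt j))"
      using coroot_sign by blast
    then have "word xs (fund_wt i) j = 0"
      using assms by (simp add: word_act_fund_wt nonneg_def order_antisym)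
    then have "word (j # xs) (fund_wt i) = word xs (fund_wt i)"
      by (simp add: word_act_Cons srefl_fixed)
    moreover have "nonpos (cact (rev (j # xs)) (fund_wt j))"
      using nonneg cact_snoc_self [of "rev xs" j] by (simp add: nonneg_def nonpos_def)
    ultimately show ?thesis
      using * [of "j # xs"] by simp
  qed
qed

text \<open>Start of the propagation: \<open>cj\<close> is chosen so that the second entry of the
  minimum is \<open>M varpi_j - 1\<close>.\<close>

lemma am_fund_wt: "am (fund_wt j)"
  using kashiwara by (simp add: am_def cj_def kashiwara_f_def)

section \<open>Rank two cosets meeting the wall of \<open>s_j\<close>\<close>

lemma pluecker:
  assumes "trop_pluecker c X" "i \<noteq> k" "nonneg (cact us (fund_wt i))" "nonneg (cact us (fund_wt k))"
  shows "c i k = -1 \<Longrightarrow> c k i = -1 \<Longrightarrow> tpr_A2 c X (word us) i k"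
    and "c i k = -2 \<Longrightarrow> c k i = -1 \<Longrightarrow> tpr_B2 c X (word us) i k"
    and "c i k = -3 \<Longrightarrow> c k i = -1 \<Longrightarrow> tpr_G2 c X (word us) i k"
  using assms wlen_ascent by (auto simp: trop_pluecker_def)

lemma level_in_residue:
  assumes "cact us (fund_wt q) = fund_wt j"
  shows "word us lam j = lam q"
proof -
  have "word us lam j = pair (fund_wt j) (word us lam)"
    by simp
  also have "\<dots> = pair (fund_wt q) lam"
    unfolding pair_word_act by (simp flip: assms)
  finally show ?thesis by simp
qed

lemma unchanged_in_residue:
  assumes "cact us (fund_wt q) = fund_wt j" "word ws (fund_wt m) q \<le> 0"
  shows "M' (word us (word ws (fund_wt m))) = M (word us (word ws (fund_wt m)))"
  using unchanged [of "us @ ws" m] assms by (simp add: word_act_append level_in_residue)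

text \<open>When \<open>us h_q = h_j\<close>, \<open>s_j us = us s_q\<close>, so the reflected
  weight lies in the same rank two coset.\<close>

lemma am_in_residue:
  assumes "cact us (fund_wt q) = fund_wt j"
  shows "am (word us (word ws lam)) \<longleftrightarrow> M' (word us (word ws lam)) =
    min (M (word us (word ws lam))) (M (word us (word (q # ws) lam)) + cj c M j)"
proof -
  have "srefl c j (word us (word ws lam)) = word us (word (q # ws) lam)"
    using fun_cong [OF word_conj [OF assms], of "word ws lam"]
    by (simp add: word_act_append word_act_Cons)
  then show ?thesis
    by (simp add: am_def)
qed

lemmas level_simps = word_act_Cons srefl_def simple_root_def fund_wt_def

text \<open>The only level one terms are \<open>N [] k\<close> and \<open>N [i] i\<close>, on
  opposite sides of the relation; all others have level at most 0. Comparing the relations for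
  \<open>M\<close> and \<open>M'\<close> transfers the formula.\<close>

lemma am_A2:
  assumes ik: "i \<noteq> k" "c i k = -1" "c k i = -1"
    and pos: "nonneg (cact us (fund_wt i))" "nonneg (cact us (fund_wt k))"
    and wall: "cact us (fund_wt k) = fund_wt j"
    and am: "am (word us (word [] (fund_wt k)))"
  shows "am (word us (word [i] (fund_wt i)))"
proof -
  have "word [k] (fund_wt k) k \<le> 0" "word [] (fund_wt i) k \<le> 0"
    "word [i, k] (fund_wt k) k \<le> 0" "word [k, i] (fund_wt i) k \<le> 0"
    using ik by (simp_all add: level_simps)
  note this [THEN unchanged_in_residue [OF wall]]
  moreover note pluecker(1) [OF trop_M ik(1) pos ik(2,3), unfolded tpr_A2_def Let_def]
    pluecker(1) [OF trop_M' ik(1) pos ik(2,3), unfolded tpr_A2_def Let_def]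
  moreover note am [unfolded am_in_residue [OF wall]]
  ultimately show ?thesis
    unfolding am_in_residue [OF wall] by linarith
qed

text \<open>The first relation suffices: it omits \<open>s_q varpi_q\<close>, which has level 2, and
  its only level one terms are the two weights in question.\<close>

lemma am_B2_long:
  assumes pq: "p \<noteq> q" "c p q = -2" "c q p = -1"
    and pos: "nonneg (cact us (fund_wt p))" "nonneg (cact us (fund_wt q))"
    and wall: "cact us (fund_wt p) = fund_wt j"
    and am: "am (word us (word [] (fund_wt p)))"
  shows "am (word us (word [q, p] (fund_wt p)))"
proof -
  have "word [p] (fund_wt p) p \<le> 0" "word [p, q] (fund_wt q) p \<le> 0"
    "word [q, p, q] (fund_wt q) p \<le> 0" "word [p, q, p] (fund_wt p) p \<le> 0" "word [] (fund_wt q) p \<le> 0"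
    using pq by (simp_all add: level_simps)
  note this [THEN unchanged_in_residue [OF wall]]
  moreover note pluecker(2) [OF trop_M pq(1) pos pq(2,3), unfolded tpr_B2_def Let_def, THEN conjunct1]
    pluecker(2) [OF trop_M' pq(1) pos pq(2,3), unfolded tpr_B2_def Let_def, THEN conjunct1]
  moreover note am [unfolded am_in_residue [OF wall]]
  ultimately show ?thesis
    unfolding am_in_residue [OF wall] by linarith
qed

text \<open>Here \<open>s_p varpi_p\<close> and \<open>s_p s_q varpi_q\<close> both have level one
  and occur together in the given relations. The inverted relations separate them, each containing
  one of them besides \<open>varpi_q\<close>.\<close>

lemma am_B2_short:
  assumes pq: "p \<noteq> q" "c p q = -2" "c q p = -1"
    and pos: "nonneg (cact us (fund_wt p))" "nonneg (cact us (fund_wt q))"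
    and wall: "cact us (fund_wt q) = fund_wt j"
    and am: "am (word us (word [] (fund_wt q)))"
  shows "am (word us (word [p] (fund_wt p)))" "am (word us (word [p, q] (fund_wt q)))"
proof -
  have "word [q] (fund_wt q) q \<le> 0" "word [q, p] (fund_wt p) q \<le> 0"
    "word [q, p, q] (fund_wt q) q \<le> 0" "word [p, q, p] (fund_wt p) q \<le> 0" "word [] (fund_wt p) q \<le> 0"
    using pq by (simp_all add: level_simps)
  note unch = this [THEN unchanged_in_residue [OF wall]]
  note rel = pluecker(2) [OF trop_M pq(1) pos pq(2,3), unfolded tpr_B2_def Let_def]
  note rel' = pluecker(2) [OF trop_M' pq(1) pos pq(2,3), unfolded tpr_B2_def Let_def]
  note inv = pluecker_B2_inverse [OF conjunct1 [OF rel] conjunct2 [OF rel]]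
    pluecker_B2_inverse [OF conjunct1 [OF rel'] conjunct2 [OF rel']]
  show "am (word us (word [p] (fund_wt p)))"
    using unch inv(1,3) am [unfolded am_in_residue [OF wall]]
    unfolding am_in_residue [OF wall] by linarith
  show "am (word us (word [p, q] (fund_wt q)))"
    using unch inv(2,4) am [unfolded am_in_residue [OF wall]]
    unfolding am_in_residue [OF wall] by linarith
qed

text \<open>The second relation avoids the weights of level 2 and 3. Its last term carries
  \<open>varpi_p\<close>, as \<open>min_shift\<close> requires.\<close>

lemma am_G2_long:
  assumes pq: "p \<noteq> q" "c p q = -3" "c q p = -1"
    and pos: "nonneg (cact us (fund_wt p))" "nonneg (cact us (fund_wt q))"
    and wall: "cact us (fund_wt p) = fund_wt j"
    and am: "am (word us (word [] (fund_wt p)))"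
  shows "am (word us (word [q, p, q, p] (fund_wt p)))"
proof -
  have "word [p] (fund_wt p) p \<le> 0" "word [p, q] (fund_wt q) p \<le> 0"
    "word [p, q, p] (fund_wt p) p \<le> 0" "word [p, q, p, q] (fund_wt q) p \<le> 0"
    "word [p, q, p, q, p] (fund_wt p) p \<le> 0" "word [q, p, q, p, q] (fund_wt q) p \<le> 0"
    "word [] (fund_wt q) p \<le> 0"
    using pq by (simp_all add: level_simps)
  note unch = this [THEN unchanged_in_residue [OF wall]]
  note rel = pluecker(3) [OF trop_M pq(1) pos pq(2,3), unfolded tpr_G2_def Let_def, THEN conjunct2, THEN conjunct1]
  note rel' = pluecker(3) [OF trop_M' pq(1) pos pq(2,3), unfolded tpr_G2_def Let_def, THEN conjunct2, THEN conjunct1]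
  show ?thesis
    unfolding am_in_residue [OF wall]
    by (rule min_shift [OF rel rel' [unfolded unch] am [unfolded am_in_residue [OF wall]]]) simp_all
qed

text \<open>Each inverted relation has one of the three targets on the left and
  \<open>varpi_q\<close> only in its last term; \<open>s_p s_q varpi_q\<close>, of level 2, is
  eliminated.\<close>

lemma am_G2_short:
  assumes pq: "p \<noteq> q" "c p q = -3" "c q p = -1"
    and pos: "nonneg (cact us (fund_wt p))" "nonneg (cact us (fund_wt q))"
    and wall: "cact us (fund_wt q) = fund_wt j"
    and am: "am (word us (word [] (fund_wt q)))"
  shows "am (word us (word [p] (fund_wt p)))" "am (word us (word [p, q, p] (fund_wt p)))"
    "am (word us (word [p, q, p, q] (fund_wt q)))"
proof -
  have "word [q] (fund_wt q) q \<le> 0" "word [q, p] (fund_wt p) q \<le> 0"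
    "word [q, p, q] (fund_wt q) q \<le> 0" "word [q, p, q, p] (fund_wt p) q \<le> 0"
    "word [p, q, p, q, p] (fund_wt p) q \<le> 0" "word [q, p, q, p, q] (fund_wt q) q \<le> 0"
    "word [] (fund_wt p) q \<le> 0"
    using pq by (simp_all add: level_simps)
  note unch = this [THEN unchanged_in_residue [OF wall]]
  note rel = pluecker(3) [OF trop_M pq(1) pos pq(2,3), unfolded tpr_G2_def Let_def]
  note rel' = pluecker(3) [OF trop_M' pq(1) pos pq(2,3), unfolded tpr_G2_def Let_def]
  note inv = pluecker_G2_inverse [OF conjunct1 [OF rel] rel [THEN conjunct2, THEN conjunct1]
      rel [THEN conjunct2, THEN conjunct2, THEN conjunct1] rel [THEN conjunct2, THEN conjunct2, THEN conjunct2]]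
  note inv' = pluecker_G2_inverse [OF conjunct1 [OF rel'] rel' [THEN conjunct2, THEN conjunct1]
      rel' [THEN conjunct2, THEN conjunct2, THEN conjunct1] rel' [THEN conjunct2, THEN conjunct2, THEN conjunct2]]
  show "am (word us (word [p] (fund_wt p)))"
    unfolding am_in_residue [OF wall]
    by (rule min_shift [OF inv(1) inv'(1) [unfolded unch] am [unfolded am_in_residue [OF wall]]]) simp_all
  show "am (word us (word [p, q, p] (fund_wt p)))"
    unfolding am_in_residue [OF wall]
    by (rule min_shift [OF inv(2) inv'(2) [unfolded unch] am [unfolded am_in_residue [OF wall]]]) simp_all
  show "am (word us (word [p, q, p, q] (fund_wt q)))"
    unfolding am_in_residue [OF wall]
    by (rule min_shift [OF inv(3) inv'(3) [unfolded unch] am [unfolded am_in_residue [OF wall]]]) simp_all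
qed

text \<open>Induction on the word: the last letter \<open>k\<close> fixes \<open>varpi_i\<close>,
  and one descends to the minimal element of the coset for \<open>i\<close> and \<open>k\<close>.
  There \<open>h_j\<close> is again the image of a simple coroot, and the rank two lemmas climb back
  to \<open>xs varpi_i\<close>.\<close>

lemma am_of_simple_coroot:
  assumes "cact xs (fund_wt i) = fund_wt j"
  shows "am (word xs (fund_wt i))"
  using assms
proof (induction "length xs" arbitrary: xs i rule: less_induct)
  case less
  note IH = less.hyps and xs = less.prems
  show ?case
  proof (cases xs rule: rev_cases)
    case Nil
    then have "i = j"
      using fun_cong [OF xs, of i] by (auto simp: fund_wt_def split: if_splits)
    then show ?thesis
      using Nil am_fund_wt by simp
  next
    case (snoc zs k)
    show ?thesis
    proof (cases "nonpos (cact zs (fund_wt k))")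
      case True
      then obtain ys where ys: "Suc (length ys) = length zs" "word xs = word ys"
        using exchange snoc by blast
      then show ?thesis
        using IH [of ys i] xs cact_cong [OF ys(2)] snoc by simp
    next
      case False
      then have k_pos: "nonneg (cact zs (fund_wt k))"
        using coroot_sign by blast
      have ik: "i \<noteq> k"
      proof
        assume "i = k"
        then have "nonpos (cact xs (fund_wt i))"
          using k_pos snoc by (simp add: cact_snoc_self nonneg_def nonpos_def)
        then show False
          using nonneg_nonpos_contr [of xs i] cact_eq_simple_nonneg [OF xs] by blast
      qed
      have zs: "cact zs (lin_comb 1 (fund_wt i) (- c i k) (fund_wt k)) = fund_wt j"
        using xs snoc by (simp add: coroot_act_append coroot_act_Cons coroot_refl_def)
      have w: "word xs (fund_wt i) = word zs (fund_wt i)"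
        using snoc ik by (simp add: word_act_append word_act_Cons)
      show ?thesis
      proof (cases "c i k = 0")
        case True
        then show ?thesis
          using IH [of zs i] zs snoc w by (simp add: lin_comb_def)
      next
        case False
        then have "c i k \<le> -1"
          using offdiag [OF ik] by linarith
        then have "nonpos (cact zs (fund_wt i))"
          using simple_coroot_indecomposable [OF zs _ _ k_pos] by simp
        then obtain z1 where z1: "Suc (length z1) = length zs" "nonneg (cact z1 (fund_wt i))"
          "\<And>lam. word zs lam = word z1 (srefl c i lam)" "\<And>x. cact zs x = cact z1 (coroot_refl c i x)"
          using descend by metis
        \<comment> \<open>The preimage of \<open>h_j\<close> is followed through the descent. While
          both its coefficients are positive, \<open>simple_coroot_indecomposable\<close> gives
          another descent; in type \<open>A_2\<close> it is already \<open>h_k\<close>.\<close>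
        have y1: "cact z1 (lin_comb (c k i * c i k - 1) (fund_wt i) (- c i k) (fund_wt k)) = fund_wt j"
          using zs unfolding z1(4) coroot_refl_pair_left by (simp add: algebra_simps)
        show ?thesis
        proof (cases "c i k = -1 \<and> c k i = -1")
          case True
          then have z1_wall: "cact z1 (fund_wt k) = fund_wt j"
            using y1 by (simp add: lin_comb_def)
          have "am (word z1 (fund_wt k))"
            using IH [OF _ z1_wall] z1(1) snoc by simp
          then show ?thesis
            using am_A2 [OF ik _ _ z1(2) _ z1_wall] True z1_wall cact_eq_simple_nonneg
            by (simp add: w z1(3) word_act_Cons)
        next
          case not_A2: False
          have gt: "1 \<le> c k i * c i k - 1" "1 \<le> - c i k"
            using cartan_rank2_cases [OF ik] not_A2 \<open>c i k \<noteq> 0\<close> by auto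
          then have "nonpos (cact z1 (fund_wt k))"
            using simple_coroot_indecomposable [of z1 "- c i k" k "c k i * c i k - 1" i j] y1 z1(2)
            by (simp add: lin_comb_def add.commute)
          then obtain z2 where z2: "Suc (length z2) = length z1" "nonneg (cact z2 (fund_wt k))"
            "\<And>lam. word z1 lam = word z2 (srefl c k lam)" "\<And>x. cact z1 x = cact z2 (coroot_refl c k x)"
            using descend by metis
          note y2 = y1 [unfolded z2(4) coroot_refl_pair_right]
          have w2: "word xs (fund_wt i) = word z2 (word [k, i] (fund_wt i))"
            by (simp add: w z1(3) z2(3) word_act_Cons)
          show ?thesis
          proof (cases "c k i * c i k = 2")
            case True
            then have B2: "c i k = -2 \<and> c k i = -1 \<or> c k i = -2 \<and> c i k = -1"
              using cartan_rank2_cases [OF ik] by auto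
            then have wall: "cact z2 (fund_wt i) = fund_wt j"
              using y2 by (auto simp: lin_comb_def)
            have am: "am (word z2 (word [] (fund_wt i)))"
              using IH [OF _ wall] z2(1) z1(1) snoc by simp
            show ?thesis
              using B2 am_B2_long [OF ik _ _ cact_eq_simple_nonneg [OF wall] z2(2) wall am]
                am_B2_short(2) [OF ik [symmetric] _ _ z2(2) cact_eq_simple_nonneg [OF wall] wall am]
              unfolding w2 by blast
          next
            case False
            then have G2: "c i k = -3 \<and> c k i = -1 \<or> c k i = -3 \<and> c i k = -1"
              using cartan_rank2_cases [OF ik] not_A2 \<open>c i k \<noteq> 0\<close> by auto
            have "nonpos (cact z2 (fund_wt i))"
              using G2 simple_coroot_indecomposable [OF y2 _ _ z2(2)] by auto
            then obtain z3 where z3: "Suc (length z3) = length z2" "nonneg (cact z3 (fund_wt i))"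
              "\<And>lam. word z2 lam = word z3 (srefl c i lam)" "\<And>x. cact z2 x = cact z3 (coroot_refl c i x)"
              using descend by metis
            note y3 = y2 [unfolded z3(4) coroot_refl_pair_left]
            have "cact z3 (lin_comb b (fund_wt k) a (fund_wt i)) = cact z3 (lin_comb a (fund_wt i) b (fund_wt k))" for a b
              by (simp add: lin_comb_def add.commute)
            note y3' = y3 [folded this]
            have "nonpos (cact z3 (fund_wt k))"
              using G2 simple_coroot_indecomposable [OF y3' _ _ z3(2)] by auto
            then obtain z4 where z4: "Suc (length z4) = length z3" "nonneg (cact z4 (fund_wt k))"
              "\<And>lam. word z3 lam = word z4 (srefl c k lam)" "\<And>x. cact z3 x = cact z4 (coroot_refl c k x)"
              using descend by metis
            note y4 = y3 [unfolded z4(4) coroot_refl_pair_right]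
            have wall: "cact z4 (fund_wt i) = fund_wt j"
              using G2 y4 by (auto simp: lin_comb_def)
            have am: "am (word z4 (word [] (fund_wt i)))"
              using IH [OF _ wall] z4(1) z3(1) z2(1) z1(1) snoc by simp
            have w4: "word xs (fund_wt i) = word z4 (word [k, i, k, i] (fund_wt i))"
              by (simp add: w2 z3(3) z4(3) word_act_Cons)
            show ?thesis
              using G2 am_G2_long [OF ik _ _ cact_eq_simple_nonneg [OF wall] z4(2) wall am]
                am_G2_short(3) [OF ik [symmetric] _ _ z4(2) cact_eq_simple_nonneg [OF wall] wall am]
              unfolding w4 by blast
          qed
        qed
      qed
    qed
  qed
qed

text \<open>\<open>s_q\<close> fixes both \<open>h_p + h_q\<close> and \<open>varpi_p\<close>, so
  \<open>v h_q\<close> may be taken positive. Then \<open>v = u s_p\<close> with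
  \<open>u h_q = h_j\<close>, and the weight is \<open>u s_p varpi_p\<close>.\<close>

lemma am_B2_sum:
  assumes pq: "p \<noteq> q" "c p q = -2" "c q p = -1"
    and v: "cact v (lin_comb 1 (fund_wt p) 1 (fund_wt q)) = fund_wt j"
  shows "am (word v (fund_wt p))"
proof -
  have main: "am (word v (fund_wt p))"
    if v: "cact v (lin_comb 1 (fund_wt p) 1 (fund_wt q)) = fund_wt j" and "nonneg (cact v (fund_wt q))" for v
  proof -
    have "nonpos (cact v (fund_wt p))"
      using simple_coroot_indecomposable [OF v _ _ that(2)] by simp
    then obtain u where u: "nonneg (cact u (fund_wt p))"
      "\<And>lam. word v lam = word u (srefl c p lam)" "\<And>x. cact v x = cact u (coroot_refl c p x)"
      using descend by metis
    have wall: "cact u (fund_wt q) = fund_wt j"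
      using v pq unfolding u(3) coroot_refl_pair_left by (simp add: lin_comb_def)
    show ?thesis
      using am_B2_short(1) [OF pq u(1) cact_eq_simple_nonneg [OF wall] wall] am_of_simple_coroot [OF wall]
      by (simp add: u(2) word_act_Cons)
  qed
  show ?thesis
  proof (cases "nonneg (cact v (fund_wt q))")
    case True
    then show ?thesis using main v by blast
  next
    case False
    then have "nonpos (cact v (fund_wt q))"
      using coroot_sign by blast
    then obtain u where u: "nonneg (cact u (fund_wt q))"
      "\<And>lam. word v lam = word u (srefl c q lam)" "\<And>x. cact v x = cact u (coroot_refl c q x)"
      using descend by metis
    have "cact u (lin_comb 1 (fund_wt p) 1 (fund_wt q)) = fund_wt j"
      using v pq unfolding u(3) coroot_refl_pair_right by simp
    then show ?thesis
      using main [of u] u(1,2) pq by simp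
  qed
qed

lemma am_G2_sum:
  assumes pq: "p \<noteq> q" "c p q = -3" "c q p = -1"
    and v: "cact v (lin_comb 1 (fund_wt p) 1 (fund_wt q)) = fund_wt j"
  shows "am (word v (fund_wt p))"
proof -
  have main: "am (word u (word [p] (fund_wt p)))" "am (word u (word [p, q, p] (fund_wt p)))"
    if "nonneg (cact u (fund_wt p))" "cact u (fund_wt q) = fund_wt j" for u
    using am_G2_short(1,2) [OF pq that(1) cact_eq_simple_nonneg [OF that(2)] that(2)]
      am_of_simple_coroot [OF that(2)] by simp_all
  show ?thesis
  proof (cases "nonneg (cact v (fund_wt q))")
    case True
    then have "nonpos (cact v (fund_wt p))"
      using simple_coroot_indecomposable [OF v] by simp
    then obtain u where u: "nonneg (cact u (fund_wt p))"
      "\<And>lam. word v lam = word u (srefl c p lam)" "\<And>x. cact v x = cact u (coroot_refl c p x)"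
      using descend by metis
    have "cact u (fund_wt q) = fund_wt j"
      using v pq unfolding u(3) coroot_refl_pair_left by (simp add: lin_comb_def)
    then show ?thesis
      using main(1) [OF u(1)] by (simp add: u(2) word_act_Cons)
  next
    case False
    \<comment> \<open>The preimage of \<open>h_j\<close> runs through \<open>h_p + 2 h_q\<close>
      (twice, being fixed by \<open>s_p\<close>), \<open>h_p + h_q\<close> and \<open>h_q\<close>;
      the weight becomes \<open>u s_p s_q s_p varpi_p\<close>.\<close>
    then have "nonpos (cact v (fund_wt q))"
      using coroot_sign by blast
    then obtain v1 where v1: "nonneg (cact v1 (fund_wt q))"
      "\<And>lam. word v lam = word v1 (srefl c q lam)" "\<And>x. cact v x = cact v1 (coroot_refl c q x)"
      using descend by metis
    note y1 = v [unfolded v1(3) coroot_refl_pair_right pq, simplified]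
    have "nonpos (cact v1 (fund_wt p))"
      using simple_coroot_indecomposable [OF y1 _ _ v1(1)] by simp
    then obtain v2 where v2: "nonneg (cact v2 (fund_wt p))"
      "\<And>lam. word v1 lam = word v2 (srefl c p lam)" "\<And>x. cact v1 x = cact v2 (coroot_refl c p x)"
      using descend by metis
    note y2 = y1 [unfolded v2(3) coroot_refl_pair_left pq, simplified]
    have "cact v2 (lin_comb 2 (fund_wt q) 1 (fund_wt p)) = fund_wt j"
      using y2 by (simp add: lin_comb_def add.commute)
    then have "nonpos (cact v2 (fund_wt q))"
      using simple_coroot_indecomposable [OF _ _ _ v2(1)] by fastforce
    then obtain v3 where v3: "nonneg (cact v3 (fund_wt q))"
      "\<And>lam. word v2 lam = word v3 (srefl c q lam)" "\<And>x. cact v2 x = cact v3 (coroot_refl c q x)"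
      using descend by metis
    note y3 = y2 [unfolded v3(3) coroot_refl_pair_right pq, simplified]
    have "nonpos (cact v3 (fund_wt p))"
      using simple_coroot_indecomposable [OF y3 _ _ v3(1)] by simp
    then obtain u where u: "nonneg (cact u (fund_wt p))"
      "\<And>lam. word v3 lam = word u (srefl c p lam)" "\<And>x. cact v3 x = cact u (coroot_refl c p x)"
      using descend by metis
    note y4 = y3 [unfolded u(3) coroot_refl_pair_left pq, simplified]
    have "cact u (fund_wt q) = fund_wt j"
      using y4 by (simp add: lin_comb_def)
    then show ?thesis
      using main(2) [OF u(1)] pq(1) by (simp add: u(2) v1(2) v2(2) v3(2) word_act_Cons)
  qed
qed

section \<open>Relations off the wall\<close>

lemma cact_in_stabilizer:
  assumes "\<And>l. l \<in> set ws \<Longrightarrow> rp l x = 0"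
  shows "cact ws x = x"
  using assms by (induction ws) (simp_all add: coroot_act_Cons coroot_refl_def lin_comb_def)

lemma cact_other: "i \<notin> set ws \<Longrightarrow> cact ws x i = x i"
  by (induction ws) (simp_all add: coroot_act_Cons coroot_refl_other)

lemma word_in_stabilizer: "i \<notin> set ws \<Longrightarrow> word ws (fund_wt i) = fund_wt i"
  by (induction ws) (auto simp: word_act_Cons)

lemma nonneg_of_coord:
  assumes "0 < cact xs (fund_wt k) i"
  shows "nonneg (cact xs (fund_wt k))"
  using assms coroot_sign [of xs k] by (auto simp: nonpos_def not_le dest: spec [of _ i])

lemma nonneg_preimage_simple:
  assumes "cact xs b = fund_wt j" "0 < b i"
  shows "nonneg b"
  using nonneg_of_coord [of "rev xs" j i] assms cact_rev(1) [of xs b] by simp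

lemma form_le_zero_imp_eq:
  assumes "form (\<lambda>l. x l - y l) (\<lambda>l. x l - y l) \<le> 0"
  shows "x = y"
proof
  fix l
  show "x l = y l"
    using form_pos [of "\<lambda>l. x l - y l" l] assms by (cases "x l = y l") auto
qed

text \<open>The hypothesis says that \<open>x - y\<close> has nonpositive norm.\<close>

lemma eq_of_form:
  assumes "form x (lin_comb 1 x (-1) y) \<le> form y (lin_comb 1 x (-1) y)"
  shows "x = y"
proof (rule form_le_zero_imp_eq)
  have "(\<lambda>l. x l - y l) = lin_comb 1 x (-1) y"
    by (simp add: lin_comb_def)
  then show "form (\<lambda>l. x l - y l) (\<lambda>l. x l - y l) \<le> 0"
    using assms by simp
qed

lemma form_nonpos:
  assumes "\<And>l. rp l x * z l \<le> 0"
  shows "form x z \<le> 0"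
  unfolding form_def using assms d_pos
  by (intro sum_nonpos divide_nonpos_pos) (simp_all del: of_int_mult)

text \<open>The reflected vector \<open>2\<beta> - y\<close> equals \<open>- s\<^sub>\<beta> y\<close>, so it is again a coroot.\<close>

lemma reflected_nonneg:
  assumes v: "cact v b = fund_wt j" and "b i = 1" "i \<notin> set ws"
    and form_yb: "form (cact ws (fund_wt i)) b * d j = 2"
  shows "nonneg (lin_comb 2 b (-1) (cact ws (fund_wt i)))"
proof -
  define y where "y = cact ws (fund_wt i)"
  have "rp j (cact v y) / d j = form (cact v y) (fund_wt j)"
    by simp
  also have "\<dots> = form y b"
    by (simp flip: v)
  finally have "real_of_int (rp j (cact v y)) = 2"
    using form_yb d_pos [of j] by (simp add: y_def field_simps)
  then have "rp j (cact v y) = 2"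
    by linarith
  then have "cact v (lin_comb 2 b (-1) y) = lin_comb (-1) (coroot_refl c j (cact v y)) 0 y"
    by (simp add: coroot_act_lin_comb v coroot_refl_def) (simp add: lin_comb_def)
  then have "lin_comb 2 b (-1) y = cact (rev v) (lin_comb (-1) (coroot_refl c j (cact v y)) 0 y)"
    by (metis cact_rev(1))
  also have "\<dots> = (\<lambda>l. - cact (rev v @ j # v @ ws) (fund_wt i) l)"
    unfolding coroot_act_lin_comb by (simp add: lin_comb_def coroot_act_append coroot_act_Cons y_def)
  finally have eq: "lin_comb 2 b (-1) y = (\<lambda>l. - cact (rev v @ j # v @ ws) (fund_wt i) l)" .
  \<comment> \<open>Letters of \<open>ws\<close> do not touch the \<open>i\<close>-coordinate, so it
    is \<open>2 - 1\<close>; one positive coordinate fixes the sign of a coroot.\<close>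
  have "lin_comb 2 b (-1) y i = 1"
    using assms(2,3) by (simp add: lin_comb_def y_def cact_other) (simp add: fund_wt_def)
  then have "\<not> nonneg (cact (rev v @ j # v @ ws) (fund_wt i))"
    unfolding eq nonneg_def by (auto intro: exI [of _ i])
  then have "nonpos (cact (rev v @ j # v @ ws) (fund_wt i))"
    using coroot_sign by blast
  then show ?thesis
    by (simp only: y_def [symmetric] eq) (simp add: nonneg_def nonpos_def)
qed

text \<open>Walks through the orbit of \<open>h_i\<close> under the simple reflections in
  \<open>L\<close>, which fix \<open>b\<close> and \<open>varpi_i\<close>, until the positive coroot
  \<open>y' = 2 b - y\<close> has been lowered to \<open>h_i\<close>.\<close>

lemma orbit_reaches_reflected:
  assumes v: "cact v b = fund_wt j" and bi: "b i = 1" and rpi: "rp i b = 1"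
    and rp_le: "\<And>l. l \<noteq> i \<Longrightarrow> rp l b \<le> 0"
    and supp: "\<And>l. l \<noteq> i \<Longrightarrow> b l = 0 \<or> rp l b = 0"
    and dj: "d j = 2 * d i"
  shows "\<exists>ws. (\<forall>l\<in>set ws. l \<noteq> i \<and> rp l b = 0) \<and> cact ws (fund_wt i) = lin_comb 2 b (-1) (fund_wt i)"
proof -
  define L where "L = {l. l \<noteq> i \<and> rp l b = 0}"
  define ht where "ht x = (\<Sum>l\<in>UNIV. x l)" for x :: "'i \<Rightarrow> int"
  have form_bb: "form b b = 2 / d j"
    using form_cact [of v b b] by (simp add: v)
  have inv: "nonneg y'" "form y' y' = form (fund_wt i) (fund_wt i)" "y' i = 1"
    if "set ws \<subseteq> L" and y': "y' = lin_comb 2 b (-1) (cact ws (fund_wt i))" for ws y'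
  proof -
    have i: "i \<notin> set ws" and ws: "cact ws b = b"
      using that(1) by (auto simp: L_def intro!: cact_in_stabilizer)
    have yb: "form (cact ws (fund_wt i)) b = 1 / d i"
      using form_cact [of ws "fund_wt i" b] by (simp add: ws rpi)
    show "nonneg y'"
      unfolding y' using d_pos [of i] by (intro reflected_nonneg [OF v bi i]) (simp add: yb dj)
    show "y' i = 1"
      using i bi by (simp add: y' lin_comb_def cact_other) (simp add: fund_wt_def)
    show "form y' y' = form (fund_wt i) (fund_wt i)"
      using d_pos [of i] by (simp add: y' form_commute [of b "cact ws (fund_wt i)"] yb form_bb dj field_simps)
  qed
  have "\<exists>us. set us \<subseteq> L \<and> cact us (fund_wt i) = lin_comb 2 b (-1) (fund_wt i)"
    if "set ws \<subseteq> L" for ws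
    using that
  proof (induction "nat (ht (lin_comb 2 b (-1) (cact ws (fund_wt i))))" arbitrary: ws rule: less_induct)
    case less
    define y where "y = cact ws (fund_wt i)"
    define y' where "y' = lin_comb 2 b (-1) y"
    note inv_y = inv [OF less.prems y'_def [unfolded y_def]]
    have yi: "y i = 1"
      using inv_y(3) bi by (simp add: y'_def lin_comb_def)
    show ?case
    proof (cases "\<exists>l\<in>L. rp l y < 0")
      case True
      \<comment> \<open>Reflecting in \<open>l\<close> raises \<open>y\<close> and lowers
        \<open>y'\<close>, whose height cannot become negative.\<close>
      then obtain l where l: "l \<in> L" "rp l y < 0" by blast
      let ?y'' = "lin_comb 2 b (-1) (cact (l # ws) (fund_wt i))"
      have "set (l # ws) \<subseteq> L"
        using l(1) less.prems by simp
      note inv_y'' = inv [OF this refl]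
      have "?y'' = lin_comb 1 y' (rp l y) (fund_wt l)"
        by (simp add: coroot_act_Cons y'_def coroot_refl_def flip: y_def)
          (simp add: lin_comb_def algebra_simps)
      then have "ht ?y'' = ht y' + rp l y * ht (fund_wt l)"
        by (simp add: ht_def lin_comb_def sum.distrib sum_distrib_left)
      moreover have "ht (fund_wt l) = 1"
        by (simp add: ht_def fund_wt_def)
      moreover have "0 \<le> ht ?y''"
        using inv_y''(1) unfolding ht_def nonneg_def by (intro sum_nonneg) blast
      ultimately have "nat (ht ?y'') < nat (ht y')"
        using l(2) by simp
      then show ?thesis
        using less.hyps [of "l # ws"] l(1) less.prems by (simp add: y'_def y_def)
    next
      case False
      have y_nonneg: "nonneg y"
        unfolding y_def by (rule nonneg_of_coord [of _ _ i]) (simp add: yi flip: y_def)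
      \<comment> \<open>No descent is left, so \<open>y'\<close> pairs nonpositively with
        \<open>alpha_l\<close> for \<open>l\<close> in \<open>L\<close>, and \<open>z\<close> is
        nonnegative with support in \<open>L\<close>.\<close>
      define z where "z = lin_comb 1 y' (-1) (fund_wt i)"
      have z_i: "z i = 0"
        using inv_y(3) by (simp add: z_def lin_comb_def) (simp add: fund_wt_def)
      have z_other: "z l = y' l" if "l \<noteq> i" for l
        using that by (simp add: z_def lin_comb_def fund_wt_def)
      have z_nonneg: "0 \<le> z l" for l
        using inv_y(1) z_i z_other [of l] by (cases "l = i") (simp_all add: nonneg_def)
      have z_out: "z l = 0" if "l \<notin> L" for l
      proof (cases "l = i")
        case True
        then show ?thesis by (simp add: z_i)
      next
        case False
        then have "b l = 0"
          using that supp [of l] by (auto simp: L_def)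
        then have "y' l = - y l"
          by (simp add: y'_def lin_comb_def)
        moreover have "0 \<le> y l" "0 \<le> y' l"
          using y_nonneg inv_y(1) by (simp_all add: nonneg_def)
        ultimately show ?thesis
          using z_other [OF False] by simp
      qed
      have "form y' z \<le> 0"
      proof (rule form_nonpos)
        fix l
        show "rp l y' * z l \<le> 0"
        proof (cases "l \<in> L")
          case True
          then have "rp l y' \<le> 0"
            using False by (auto simp: y'_def L_def not_less)
          then show ?thesis
            using z_nonneg by (simp add: mult_le_0_iff)
        qed (simp add: z_out)
      qed
      moreover have "form (fund_wt i) z \<le> 0"
      proof (rule form_nonpos)
        fix l
        show "rp l (fund_wt i) * z l \<le> 0"
          using z_nonneg [of l] z_i offdiag [of i l] by (cases "l = i") (simp_all add: mult_le_0_iff)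
      qed
      \<comment> \<open>\<open>y'\<close> and \<open>h_i\<close> have equal norm, so two nonpositive
        products are opposite and both vanish.\<close>
      moreover have "form y' z = - form (fund_wt i) z"
        using inv_y(2) by (simp only: z_def form_lin_comb_right form_commute [of y' "fund_wt i"])
      ultimately have "form y' z \<le> form (fund_wt i) z"
        by linarith
      then have "y' = fund_wt i"
        unfolding z_def by (rule eq_of_form)
      moreover have "y = lin_comb 2 b (-1) y'"
        by (simp add: y'_def lin_comb_def)
      ultimately have "y = lin_comb 2 b (-1) (fund_wt i)"
        by simp
      then show ?thesis
        using less.prems by (auto simp: y_def)
    qed
  qed
  from this [of "[]"] show ?thesis
    by (auto simp: L_def)
qed

lemma sign_change_step:
  assumes "nonneg (cact v x) \<noteq> nonneg (cact (v @ ws) x)"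
  shows "\<exists>as l. set (l # as) \<subseteq> set ws \<and> nonneg (cact (v @ as) x) \<noteq> nonneg (cact (v @ as @ [l]) x)"
  using assms
proof (induction ws rule: rev_induct)
  case (snoc l ws)
  show ?case
  proof (cases "nonneg (cact (v @ ws) x) = nonneg (cact v x)")
    case True
    then show ?thesis
      using snoc.prems by (intro exI [of _ ws] exI [of _ l]) auto
  next
    case False
    then show ?thesis
      using snoc.IH by fastforce
  qed
qed simp

text \<open>Here the three-term relation at \<open>u\<close> determines \<open>M'\<close> at \<open>u s\<^sub>i \<varpi>\<^sub>i\<close> from chamber weights of type
  \<open>k\<close>, and the relation at \<open>s\<^sub>j u\<close> is its image under \<open>s\<^sub>j\<close>.\<close>

lemma am_A2_off_wall:
  assumes ik: "i \<noteq> k" "c i k = -1" "c k i = -1"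
    and pos: "nonneg (cact u (fund_wt i))" "nonneg (cact u (fund_wt k))"
    and g: "cact u g = fund_wt j" "g i = 0" "rp i g = -1" "g k = 1" "rp k g = 1" "g \<noteq> fund_wt k"
    and am: "am (word u (word [] (fund_wt k)))" "am (word u (word [i, k] (fund_wt k)))"
  shows "am (word u (word [i] (fund_wt i)))"
proof -
  have g_eq: "g = cact (rev u) (fund_wt j)"
    by (simp flip: g(1))
  have level: "word u lam j = pair g lam" for lam
    using pair_word_act [of "fund_wt j" c u lam] by (simp add: g_eq)
  have pair_refl: "pair g (srefl c m lam) = pair g lam - rp m g * lam m" for m lam
    unfolding pair_coroot_refl [symmetric] coroot_refl_def
    by (simp add: pair_def lin_comb_def fund_wt_def sum.distrib sum_distrib_left sum_subtractf algebra_simps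
        if_distrib [of "\<lambda>x. _ * x"] cong: if_cong)
  have zero: "word u (word [k] (fund_wt k)) j = 0" "word u (word [] (fund_wt i)) j = 0"
    "word u (word [k, i] (fund_wt i)) j = 0"
    unfolding level using ik g by (simp_all add: word_act_Cons pair_refl) (simp_all add: level_simps)
  have unch: "M' (word u (word ws (fund_wt m))) = M (word u (word ws (fund_wt m)))"
    if "word u (word ws (fund_wt m)) j = 0" for ws m
    using unchanged [of "u @ ws" m] that by (simp add: word_act_append)
  have fixed: "srefl c j (word u (word ws (fund_wt m))) = word u (word ws (fund_wt m))"
    if "word u (word ws (fund_wt m)) j = 0" for ws m
    using that by (rule srefl_fixed)
  have ju: "word (j # u) lam = srefl c j (word u lam)" for lam
    by (simp add: word_act_Cons)
  \<comment> \<open>\<open>s_j\<close> makes the positive coroot \<open>u h_m\<close> negative only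
    if it equals \<open>h_j\<close>, that is, if \<open>g = h_m\<close>.\<close>
  have "nonneg (cact (j # u) (fund_wt m))" if "nonneg (cact u (fund_wt m))" "g \<noteq> fund_wt m" for m
  proof (rule ccontr)
    assume "\<not> nonneg (cact (j # u) (fund_wt m))"
    then have "nonpos (cact (j # u) (fund_wt m))"
      using coroot_sign by blast
    then have "cact u (fund_wt m) = fund_wt j"
      using that(1) by (intro flipped_coroot_simple) (simp_all add: coroot_act_Cons)
    then have "g = fund_wt m"
      by (metis g_eq cact_rev(1))
    then show False
      using that(2) by simp
  qed
  moreover have "g \<noteq> fund_wt i"
    using g(2) by (auto simp: fund_wt_def)
  ultimately have pos': "nonneg (cact (j # u) (fund_wt i))" "nonneg (cact (j # u) (fund_wt k))"
    using pos g(6) by simp_all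
  \<comment> \<open>All level zero terms agree. The relation at \<open>s_j u\<close>, shifted by
    \<open>cj c M j\<close>, and the one at \<open>u\<close> have as their minimum the relation for
    \<open>M'\<close>.\<close>
  note pluecker(1) [OF trop_M ik(1) pos ik(2,3), unfolded tpr_A2_def Let_def]
    pluecker(1) [OF trop_M' ik(1) pos ik(2,3), unfolded tpr_A2_def Let_def, unfolded zero [THEN unch]]
    pluecker(1) [OF trop_M ik(1) pos' ik(2,3), unfolded tpr_A2_def Let_def, unfolded ju zero [THEN fixed]]
  then show ?thesis
    using am unfolding am_def by linarith
qed

text \<open>Seeks a representative \<open>x\<close> of the same weight with
  \<open>x b = h_j\<close>, \<open>x h_i\<close> negative and \<open>x (h_i + h_k)\<close> positive.
  Then \<open>x s_i\<close> satisfies the positivity conditions of \<open>am_A2_off_wall\<close>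
  with \<open>g = b - h_i\<close>.\<close>

lemma am_A2_sum:
  assumes ik: "i \<noteq> k" "c i k = -1" "c k i = -1"
    and v: "cact v b = fund_wt j" and bi: "b i = 1" and bk: "b k = 1"
    and rpi: "rp i b = 1" and rpk: "rp k b = 0"
    and nbrs: "\<And>l. l \<noteq> i \<Longrightarrow> l \<noteq> k \<Longrightarrow> b l * c l i = 0"
    and rp_le: "\<And>l. l \<noteq> i \<Longrightarrow> rp l b \<le> 0"
    and IH: "\<And>xs. cact xs (coroot_refl c i b) = fund_wt j \<Longrightarrow> am (word xs (fund_wt k))"
  shows "am (word v (fund_wt i))"
proof -
  have b_nonneg: "0 \<le> b l" for l
    using nonneg_preimage_simple [OF v, of i] bi by (simp add: nonneg_def)
  have form_bb: "form b b = 2 / d j"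
    using form_cact [of v b b] by (simp add: v)
  have dik: "d k = d i"
    using symmetrizable [of i k] ik by simp
  \<comment> \<open>Here \<open>(b, b) = 2 / d j\<close> equals \<open>1 / d i + s\<close> with
    \<open>s\<close> nonpositive, so \<open>d j\<close> is at least \<open>2 * d i\<close>; equality
    will make every term of \<open>s\<close> vanish.\<close>
  define s where "s = (\<Sum>l\<in>UNIV - {i}. real_of_int (rp l b * b l) / d l)"
  have s_le: "real_of_int (rp l b * b l) / d l \<le> 0" if "l \<noteq> i" for l
    using rp_le [OF that] b_nonneg [of l] d_pos [of l] by (simp add: divide_nonpos_pos mult_nonpos_nonneg del: of_int_mult)
  have "form b b = 1 / d i + s"
    unfolding form_def s_def using rpi bi by (subst sum.remove [of _ i]) simp_all
  moreover have "s \<le> 0"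
    unfolding s_def using s_le by (intro sum_nonpos) simp
  ultimately have "2 / d j \<le> 1 / d i"
    by (simp add: form_bb)
  then have dj_ge: "2 * d i \<le> d j"
    using d_pos [of i] d_pos [of j] by (simp add: field_simps)
  \<comment> \<open>The norm of \<open>3 b - 2 h_i - h_k\<close> is
    \<open>18 / d j - 6 / d i\<close>; its positivity excludes ratios \<open>d j / d i\<close> of 3
    or more, and the ratio is an integer.\<close>
  define x where "x = lin_comb 1 (lin_comb 3 b (-2) (fund_wt i)) (-1) (fund_wt k)"
  have "x i = 1"
    using ik bi by (simp add: x_def lin_comb_def fund_wt_def)
  then have "0 < form x x"
    by (intro form_pos [of _ i]) simp
  also have "form x x = 18 / d j - 6 / d i"
    using ik dik d_pos [of i] by (simp add: x_def form_bb rpi rpk field_simps)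
  finally have dj_less: "d j < 3 * d i"
    using d_pos [of i] d_pos [of j] by (simp add: field_simps)
  have "real_of_int (rp j (cact v (fund_wt i))) / d j = form (fund_wt i) b"
    using form_cact [of v "fund_wt i" b] by (simp add: v)
  then have dj_int: "d j = real_of_int (rp j (cact v (fund_wt i))) * d i"
    using d_pos [of i] d_pos [of j] by (simp add: rpi field_simps)
  moreover have "rp j (cact v (fund_wt i)) = 2"
  proof -
    have "2 \<le> real_of_int (rp j (cact v (fund_wt i)))" "real_of_int (rp j (cact v (fund_wt i))) < 3"
      using dj_ge dj_less d_pos [of i] unfolding dj_int by simp_all
    then show ?thesis by linarith
  qed
  ultimately have dj: "d j = 2 * d i"
    by simp
  have "s = 0"
    using \<open>form b b = 1 / d i + s\<close> d_pos [of i] by (simp add: form_bb dj)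
  then have term_0: "real_of_int (rp l b * b l) / d l = 0" if "l \<noteq> i" for l
    using s_le that sum_nonneg_eq_0_iff [of "UNIV - {i}" "\<lambda>l. - (real_of_int (rp l b * b l) / d l)"]
    unfolding s_def by (simp add: sum_negf)
  have supp: "b l = 0 \<or> rp l b = 0" if "l \<noteq> i" for l
    using term_0 [OF that] d_pos [of l] by auto
  obtain ws where ws: "\<And>l. l \<in> set ws \<Longrightarrow> l \<noteq> i \<and> rp l b = 0"
    "cact ws (fund_wt i) = lin_comb 2 b (-1) (fund_wt i)"
    using orbit_reaches_reflected [OF v bi rpi rp_le supp dj] by blast
  have reflected: "cact v (cact ws (fund_wt i)) = lin_comb 2 (fund_wt j) (-1) (cact v (fund_wt i))"
    by (simp add: ws(2) coroot_act_lin_comb v)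
  \<comment> \<open>The two coroots add up to \<open>2 h_j\<close>. If both were positive,
    \<open>s_j\<close> would flip \<open>v h_i\<close>, forcing \<open>b = h_i\<close>; if both were
    negative, their \<open>j\<close>-coordinates could not add up to 2.\<close>
  have "nonneg (cact v (fund_wt i)) \<noteq> nonneg (cact (v @ ws) (fund_wt i))"
  proof
    assume eq: "nonneg (cact v (fund_wt i)) = nonneg (cact (v @ ws) (fund_wt i))"
    show False
    proof (cases "nonneg (cact v (fund_wt i))")
      case True
      have "coroot_refl c j (cact v (fund_wt i)) = lin_comb (-1) (cact (v @ ws) (fund_wt i)) 0 b"
        using \<open>rp j (cact v (fund_wt i)) = 2\<close>
        by (simp add: coroot_refl_def coroot_act_append reflected) (simp add: lin_comb_def)
      then have "nonpos (coroot_refl c j (cact v (fund_wt i)))"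
        using True eq by (simp add: nonneg_def nonpos_def lin_comb_def)
      then have "cact v (fund_wt i) = fund_wt j"
        using True by (intro flipped_coroot_simple)
      then have "b = fund_wt i"
        using v by (metis cact_rev(1))
      then show False
        using bk ik by (simp add: fund_wt_def)
    next
      case False
      then have "nonpos (cact v (fund_wt i))" "nonpos (cact (v @ ws) (fund_wt i))"
        using eq coroot_sign by blast+
      then have "cact v (fund_wt i) j \<le> 0" "2 - cact v (fund_wt i) j \<le> 0"
        unfolding nonpos_def coroot_act_append reflected by (auto simp: lin_comb_def fund_wt_def dest!: spec [of _ j])
      then show False by simp
    qed
  qed
  then obtain as l where as: "set (l # as) \<subseteq> set ws"
    "nonneg (cact (v @ as) (fund_wt i)) \<noteq> nonneg (cact (v @ as @ [l]) (fund_wt i))"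
    using sign_change_step by blast
  have l: "l \<noteq> i" "rp l b = 0"
    using as(1) ws(1) by auto
  have cil: "c i l \<noteq> 0"
  proof
    assume "c i l = 0"
    then have "coroot_refl c l (fund_wt i) = fund_wt i"
      by (simp add: coroot_refl_def lin_comb_def)
    then show False
      using as(2) by (simp add: coroot_act_append coroot_act_Cons)
  qed
  \<comment> \<open>Any other neighbour \<open>l\<close> of \<open>i\<close> has
    \<open>b l = 0\<close>, whence \<open><b, alpha_l>\<close> is at most \<open>c i l\<close>,
    which is negative.\<close>
  have "l = k"
  proof (rule ccontr)
    assume "l \<noteq> k"
    then have "b l = 0"
      using nbrs [OF l(1)] cil zero_iff [of i l] by auto
    have "b m * c m l \<le> 0" for m
      using b_nonneg [of m] offdiag [of m l] \<open>b l = 0\<close> by (cases "m = l") (simp_all add: mult_nonneg_nonpos)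
    then have "rp l b \<le> b i * c i l"
      unfolding root_pair_def by (subst sum.remove [of _ i]) (auto intro: sum_nonpos)
    then show False
      using bi l cil offdiag [of i l] by simp
  qed
  have fixed: "cact as b = b" "word as (fund_wt i) = fund_wt i"
    using as(1) ws(1) by (auto intro!: cact_in_stabilizer word_in_stabilizer)
  have refl_b: "coroot_refl c k b = b"
    by (simp add: coroot_refl_def rpk lin_comb_def)
  \<comment> \<open>With \<open>u = x s_i\<close>, the weights \<open>u varpi_k\<close> and
    \<open>u s_i s_k varpi_k = x s_k varpi_k\<close> fall under \<open>IH\<close>, the latter
    because \<open>s_k\<close> fixes \<open>b\<close>.\<close>
  have main: "am (word x (fund_wt i))"
    if x: "cact x b = fund_wt j" and neg: "\<not> nonneg (cact x (fund_wt i))"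
      and pos: "nonneg (cact x (coroot_refl c k (fund_wt i)))" for x
  proof -
    have refl_k: "coroot_refl c i (fund_wt k) = coroot_refl c k (fund_wt i)"
      using ik by (simp add: coroot_refl_def lin_comb_def add.commute)
    have "nonpos (cact x (fund_wt i))"
      using neg coroot_sign by blast
    then have u_pos: "nonneg (cact (x @ [i]) (fund_wt i))" "nonneg (cact (x @ [i]) (fund_wt k))"
      using pos by (simp_all only: cact_snoc_self) (simp_all add: nonneg_def nonpos_def coroot_act_append coroot_act_Cons refl_k)
    let ?g = "coroot_refl c i b"
    have ug: "cact (x @ [i]) ?g = fund_wt j"
      by (simp add: coroot_act_append coroot_act_Cons x)
    have g: "?g i = 0" "rp i ?g = -1" "?g k = 1" "rp k ?g = 1" "?g \<noteq> fund_wt k"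
    proof -
      show "?g i = 0" "?g k = 1"
        using ik bi bk rpi by (simp_all add: coroot_refl_def lin_comb_def fund_wt_def)
      show "rp i ?g = -1" "rp k ?g = 1"
        using ik rpi rpk by (simp_all add: coroot_refl_def)
      then show "?g \<noteq> fund_wt k"
        by auto
    qed
    have am1: "am (word (x @ [i]) (word [] (fund_wt k)))"
      using IH [OF ug] by simp
    have "cact (x @ [k, i]) ?g = fund_wt j"
      by (simp add: coroot_act_append coroot_act_Cons x refl_b)
    note IH [OF this]
    then have am2: "am (word (x @ [i]) (word [i, k] (fund_wt k)))"
      using ik by (simp add: word_act_append word_act_Cons)
    show ?thesis
      using am_A2_off_wall [OF ik u_pos ug g am1 am2] by (simp add: word_act_append word_act_Cons)
  qed
  \<comment> \<open>The end of the sign change at which \<open>h_i\<close> is negative serves as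
    \<open>x\<close>.\<close>
  show ?thesis
  proof (cases "nonneg (cact (v @ as) (fund_wt i))")
    case False
    then show ?thesis
      using main [of "v @ as"] as(2) \<open>l = k\<close> v fixed
      by (simp add: coroot_act_append coroot_act_Cons word_act_append)
  next
    case True
    then show ?thesis
      using main [of "v @ as @ [k]"] as(2) \<open>l = k\<close> v fixed ik(1) refl_b
      by (simp add: coroot_act_append coroot_act_Cons word_act_append word_act_Cons)
  qed
qed

section \<open>Arbitrary weights of level one, by induction on the height of the coroot\<close>

lemma am_of_level_one:
  assumes "cact v b = fund_wt j" "b i = 1"
  shows "am (word v (fund_wt i))"
  using assms
proof (induction "nat (\<Sum>l\<in>UNIV. b l)" arbitrary: v i b rule: less_induct)
  case less
  note v = less.prems(1) and bi = less.prems(2)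
  have b_nonneg: "0 \<le> b l" for l
    using nonneg_preimage_simple [OF v, of i] bi by (simp add: nonneg_def)
  have IH: "am (word xs (fund_wt m))"
    if "cact xs (coroot_refl c l b) = fund_wt j" "0 < rp l b" "coroot_refl c l b m = 1" for xs l m
  proof -
    have "(\<Sum>n\<in>UNIV. coroot_refl c l b n) = (\<Sum>n\<in>UNIV. b n) - rp l b * (\<Sum>n\<in>UNIV. fund_wt l n)"
      by (simp add: coroot_refl_def lin_comb_def sum.distrib sum_distrib_left sum_subtractf)
    also have "(\<Sum>n\<in>UNIV. fund_wt l n) = (1 :: int)"
      by (simp add: fund_wt_def)
    finally have "(\<Sum>n\<in>UNIV. coroot_refl c l b n) < (\<Sum>n\<in>UNIV. b n)"
      using that(2) by simp
    moreover have "b i \<le> (\<Sum>n\<in>UNIV. b n)"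
      using b_nonneg by (intro member_le_sum) auto
    ultimately show ?thesis
      using bi that(1,3) by (intro less.hyps [of "coroot_refl c l b"]) auto
  qed
  show ?case
  proof (cases "\<exists>k. k \<noteq> i \<and> 0 < rp k b")
    case True
    \<comment> \<open>\<open>s_k\<close> fixes \<open>varpi_i\<close> and lowers \<open>b\<close>
      while keeping its \<open>i\<close>-coefficient.\<close>
    then obtain k where k: "k \<noteq> i" "0 < rp k b" by blast
    have "cact (v @ [k]) (coroot_refl c k b) = fund_wt j"
      by (simp add: coroot_act_append coroot_act_Cons v)
    then have "am (word (v @ [k]) (fund_wt i))"
      using k bi coroot_refl_other [of i k c b] by (intro IH) auto
    then show ?thesis
      using k(1) by (simp add: word_act_append word_act_Cons)
  next
    case False
    then have rp_le: "rp l b \<le> 0" if "l \<noteq> i" for l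
      using that by force
    have form_b_le: "form b z \<le> 0" if "z i = 0" "\<And>l. 0 \<le> z l" for z
    proof (rule form_nonpos)
      fix l
      show "rp l b * z l \<le> 0"
        using that rp_le [of l] by (cases "l = i") (simp_all add: mult_nonpos_nonneg)
    qed
    \<comment> \<open>\<open>b - h_i\<close> is nonnegative and supported off \<open>i\<close>, so
      \<open>(b, b - h_i)\<close> is nonpositive, and positivity of the norm forces
      \<open><b, alpha_i>\<close> to be positive.\<close>
    have "0 < form b b"
      using bi by (intro form_pos [of b i]) simp
    moreover have "form b b = rp i b / d i + form b (lin_comb 1 b (-1) (fund_wt i))"
      by simp
    moreover have rest: "form b (lin_comb 1 b (-1) (fund_wt i)) \<le> 0"
      using bi b_nonneg by (intro form_b_le) (auto simp: lin_comb_def fund_wt_def)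
    ultimately have "0 < rp i b / d i"
      by linarith
    then have rpi_pos: "1 \<le> rp i b"
      using d_pos [of i] by (simp add: zero_less_divide_iff)
    have term_le: "b l * c l i \<le> 0" if "l \<noteq> i" for l
      using b_nonneg [of l] offdiag [OF that] by (simp add: mult_nonneg_nonpos)
    have rpi_eq: "rp i b = 2 + (\<Sum>l\<in>UNIV - {i}. b l * c l i)"
      unfolding root_pair_def using bi by (subst sum.remove [of _ i]) simp_all
    show ?thesis
    proof (cases "\<exists>k. k \<noteq> i \<and> b k * c k i \<noteq> 0")
      case False
      then have "(\<Sum>l\<in>UNIV - {i}. b l * c l i) = 0"
        by (intro sum.neutral) auto
      then have "rp i b = 2"
        by (simp add: rpi_eq)
      then have "form (fund_wt i) (lin_comb 1 b (-1) (fund_wt i)) = 0"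
        by simp
      then have "b = fund_wt i"
        using rest by (intro eq_of_form) linarith
      then show ?thesis
        using am_of_simple_coroot v by simp
    next
      case True
      then obtain k where k: "k \<noteq> i" "b k * c k i \<noteq> 0" by blast
      \<comment> \<open>The neighbours of \<open>i\<close> can contribute only -1 in total to
        \<open><b, alpha_i>\<close>: there is a single \<open>k\<close>, with \<open>b k = 1\<close>
        and \<open>c k i = -1\<close>.\<close>
      have split_k: "(\<Sum>l\<in>UNIV - {i}. b l * c l i) = b k * c k i + (\<Sum>l\<in>UNIV - {i} - {k}. b l * c l i)"
        using k(1) by (subst sum.remove [of _ k]) simp_all
      have "(\<Sum>l\<in>UNIV - {i} - {k}. b l * c l i) \<le> 0"
        using term_le by (intro sum_nonpos) simp
      then have bkc: "b k * c k i = -1" and others: "(\<Sum>l\<in>UNIV - {i} - {k}. b l * c l i) = 0"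
        using rpi_pos rpi_eq split_k term_le [OF k(1)] k(2) by linarith+
      have rpi: "rp i b = 1"
        using rpi_eq split_k bkc others by simp
      have nbrs: "b l * c l i = 0" if "l \<noteq> i" "l \<noteq> k" for l
        using others that term_le sum_nonneg_eq_0_iff [of "UNIV - {i} - {k}" "\<lambda>l. - (b l * c l i)"]
        by (simp add: sum_negf)
      have "b k * (- c k i) = 1"
        using bkc by simp
      then have bk: "b k = 1" and cki: "c k i = -1"
        using b_nonneg [of k] zmult_eq_1_iff [of "b k" "- c k i"] by auto
      define r where "r = - c i k"
      have r: "r \<in> {1, 2, 3}"
        using cartan_rank2_cases [OF k(1) [symmetric]] cki by (auto simp: r_def)
      have dk: "d k = r * d i"
        using symmetrizable [of i k] cki by (simp add: r_def mult.commute [of _ "d i"])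
      define z where "z = lin_comb 1 (lin_comb 1 b (-1) (fund_wt i)) (-1) (fund_wt k)"
      have z: "z i = 0" "z k = 0" "l \<noteq> i \<Longrightarrow> l \<noteq> k \<Longrightarrow> z l = b l" for l
        using k(1) bi bk by (simp_all add: z_def lin_comb_def fund_wt_def)
      have z_nonneg: "0 \<le> z l" for l
        using z b_nonneg by (metis order_refl)
      have form_bz: "form b z \<le> 0"
        using z(1) z_nonneg by (rule form_b_le)
      have form_bb: "form b b = 1 / d i + rp k b / d k + form b z"
        by (simp add: z_def rpi)
      \<comment> \<open>The norm of \<open>2 b - h_i\<close> is \<open>4 (b, b) - 2 / d i\<close>;
        its positivity bounds \<open><b, alpha_k>\<close> from below.\<close>
      have "0 < form (lin_comb 2 b (-1) (fund_wt i)) (lin_comb 2 b (-1) (fund_wt i))"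
        using bi by (intro form_pos [of _ i]) (simp add: lin_comb_def fund_wt_def)
      also have "\<dots> = 4 * form b b - 2 * (1 / d i)"
        using d_pos [of i] by (simp add: rpi field_simps)
      finally have "1 / d i < 2 * (1 / d i + rp k b / d k)"
        using form_bz form_bb by (smt (verit))
      then have rpk_gt: "- r < 2 * rp k b"
      proof -
        assume "1 / d i < 2 * (1 / d i + rp k b / d k)"
        then have "0 < 1 / d i + 2 * rp k b / (r * d i)"
          by (simp add: dk)
        also have "\<dots> = (r + 2 * rp k b) / (r * d i)"
          using r d_pos [of i] by (auto simp: field_simps)
        finally have "0 < real_of_int (r + 2 * rp k b)"
          using r d_pos [of i] by (auto simp: zero_less_divide_iff)
        then show ?thesis by linarith
      qed
      have rpk_le: "rp k b \<le> 0"
        using rp_le k(1) by blast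
      have rpk_z: "rp k z = rp k b - (2 - r)"
        by (simp add: z_def r_def)
      have "z l * c l k \<le> 0" for l
        using z_nonneg [of l] z(2) offdiag [of l k] by (cases "l = k") (simp_all add: mult_nonneg_nonpos)
      then have rpk_z_le: "rp k z \<le> 0"
        unfolding root_pair_def by (intro sum_nonpos) simp
      show ?thesis
      proof (cases "r = 1")
        case True
        then have "c i k = -1" "rp k b = 0"
          using rpk_gt rpk_le by (simp_all add: r_def)
        moreover have "coroot_refl c i b k = 1"
          using coroot_refl_other [OF k(1), of c b] bk by simp
        ultimately show ?thesis
          using IH [of _ i k] rpi nbrs rp_le
          by (intro am_A2_sum [OF k(1) [symmetric] _ cki v bi bk rpi]) auto
      next
        case False
        \<comment> \<open>The two bounds force \<open><b, alpha_k> = 2 - r\<close>. So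
          \<open>z\<close> is orthogonal to \<open>h_i\<close> and \<open>h_k\<close>, and
          \<open>(z, z) = (b, z)\<close> is nonpositive, whence
          \<open>b = h_i + h_k\<close>.\<close>
        then have "rp k z = 0"
          using r rpk_gt rpk_le rpk_z rpk_z_le by auto
        moreover have "rp i z = 0"
          using rpi cki by (simp add: z_def)
        moreover have "form z w = form b w - rp i w / d i - rp k w / d k" for w
          by (simp add: z_def)
        ultimately have "form z z = form b z"
          by simp
        then have "z l = 0" for l
          using form_pos [of z l] form_bz by force
        moreover have "b l = z l + lin_comb 1 (fund_wt i) 1 (fund_wt k) l" for l
          by (simp add: z_def lin_comb_def)
        ultimately have "b = lin_comb 1 (fund_wt i) 1 (fund_wt k)"
          by (intro ext) simp
        then show ?thesis
          using am_B2_sum [OF k(1) [symmetric] _ cki] am_G2_sum [OF k(1) [symmetric] _ cki] v r False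
          by (auto simp: r_def)
      qed
    qed
  qed
qed

end

theorem theorem3p5:
  fixes c :: "'i::finite \<Rightarrow> 'i \<Rightarrow> int"
    and M M' :: "'i weight \<Rightarrow> int"
    and j :: 'i
  assumes "simple_cartan c"
    and "mv_datum c M"
    and "mv_normalized c M"
    and "kashiwara_f c j M M'"
  shows "\<forall>\<gamma>\<in>chamber_weights c. \<gamma> j = 1 \<longrightarrow>
           M' \<gamma> = min (M \<gamma>) (M (srefl c j \<gamma>) + cj c M j)"
proof (intro ballI impI)
  fix \<gamma>
  assume "\<gamma> \<in> chamber_weights c" and level: "\<gamma> j = 1"
  then obtain xs i where \<gamma>: "\<gamma> = word_act c xs (fund_wt i)"
    by (auto simp: chamber_weights_def weyl_def)
  obtain d where "cartan c d"
    using assms(1) by (auto simp: simple_cartan_def cartan_def)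
  then interpret kashiwara c d M M' j
    using assms(2,4) by (simp add: kashiwara_def kashiwara_axioms_def mv_datum_def)
  have "am \<gamma>"
    unfolding \<gamma>
    using level by (intro am_of_level_one [of xs "cact (rev xs) (fund_wt j)"]) (simp_all add: \<gamma> word_act_fund_wt)
  then show "M' \<gamma> = min (M \<gamma>) (M (srefl c j \<gamma>) + cj c M j)"
    by (simp add: am_def)
qed

end
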